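(* Let $p$ be an odd prime and $n\geqslant1$. Let $S=(s_1,\ldots,s_k)$ with $1\leqslant s_1<\cdots<s_k<n$ ($0\leqslant k\leqslant n-1$), let $S'=(s_{k+1},\ldots,s_{n-1})$, $s_{k+1}<\cdots<s_{n-1}$, be the ordered complement of $S$ in $\{1,\ldots,n-1\}$, and set $s_0=0$. Then for every sequence $R=(r_1,\ldots,r_n)$ of non-negative integers, $$St^{S',R}M_{n,1,\ldots,n-1}=\begin{cases}(-1)^{(k-1)(n-1-k)+s_t-t}\,M_{n,s_0,\ldots,\hat s_t,\ldots,s_k}, & R=\Delta_{s_t},\ 0\leqslant t\leqslant k,\\[4pt] \displaystyle\sum_{t=0}^{k}(-1)^{k(n-k)-t}\,M_{n,s_0,\ldots,\hat s_t,\ldots,s_k}\,Q_{n,s_t}, & R=\Delta_n,\\[4pt] 0, & \text{otherwise.}\end{cases}$$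
   Context: All cohomology has coefficients in $\mathbb Z/p$. $H^*(B(\mathbb Z/p)^n)=E(x_1,\ldots,x_n)\otimes P(y_1,\ldots,y_n)$ with $\dim x_i=1$, $y_i=\beta x_i$ ($\beta$ the Bockstein), $E$ exterior and $P$ polynomial algebra over $\mathbb Z/p$. A hat denotes omission. For non-negative integers $a_{k+1},\ldots,a_n$, define $$[k;a_{k+1},\ldots,a_n]=\sum_I \operatorname{sign}(\sigma_I)\,x_{i_1}\cdots x_{i_k}\,\det\big(y_{i_u}^{p^{a_v}}\big)_{k+1\leqslant u,v\leqslant n},$$ the sum over all $k$-element subsets $I=\{i_1<\cdots<i_k\}$ of $\{1,\ldots,n\}$ with complement $\{i_{k+1}<\cdots<i_n\}$, and $\sigma_I$ the permutation $j\mapsto i_j$. For $k=0$ write $[a_1,\ldots,a_n]=\det(y_i^{p^{a_j}})$. Set $L_{n,s}=[0,\ldots,\hat s,\ldots,n]$ for $0\leqslant s\leqslant n$, $L_n=L_{n,n}=[0,\ldots,n-1]$. Dickson invariants: $Q_{n,s}=L_{n,s}/L_n$ (a polynomial). M\`ui invariants: for $0\leqslant u_1<\cdots<u_k\leqslant n-1$, $M_{n,u_1,\ldots,u_k}=[k;0,\ldots,\hat u_1,\ldots,\hat u_k,\ldots,n-1]$; with an empty list of indices ($k=0$) this is $[0,\ldots,n-1]=L_n$. $\Delta_i=(0,\ldots,1,\ldots,0)$ is the sequence of length $n$ with $1$ in the $i$-th place ($1\leqslant i\leqslant n$), and $\Delta_0=(0,\ldots,0)$. Let $\mathcal A(p)$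 be the mod $p$ Steenrod algebra. Its dual is $\mathcal A(p)^*=E(\tau_0,\tau_1,\ldots)\otimes P(\xi_1,\xi_2,\ldots)$ (Milnor), $\dim\tau_s=2p^s-1$, $\dim\xi_i=2p^i-2$. It has the basis of monomials $\tau_S\xi^R=\tau_{s_1}\cdots\tau_{s_t}\xi_1^{r_1}\cdots\xi_m^{r_m}$ ($S=(s_1,\ldots,s_t)$, $0\leqslant s_1<\cdots<s_t$, $R=(r_1,\ldots,r_m)$), and $St^{S,R}\in\mathcal A(p)$ is the element of the dual basis dual to $\tau_S\xi^R$. The action (Milnor's sign convention) is determined as follows: the ring homomorphism $\lambda:H^*(B(\mathbb Z/p)^n)\to H^*(B(\mathbb Z/p)^n)\widehat\otimes\mathcal A(p)^*$ (graded tensor product with Koszul signs) given by $\lambda(x_i)=x_i\otimes1+\sum_{s\geqslant0}y_i^{p^s}\otimes\tau_s$, $\lambda(y_i)=\sum_{s\geqslant0}y_i^{p^s}\otimes\xi_s$ ($\xi_0=1$) satisfies $\lambda(u)=\sum_{S,R}(-1)^{t(\dim u-t)}St^{S,R}u\otimes\tau_S\xi^R$, where $t$ is the length of $S$. *)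

theory Defs
  imports
    "HOL-Library.Poly_Mapping"
    "HOL-Library.FSet"
    "HOL-Combinatorics.Permutations"
    "Jordan_Normal_Form.Determinant"
    "Berlekamp_Zassenhaus.Finite_Field"
begin

section \<open>Signs of shuffles and convolution sums\<close>

definition inversions :: "nat fset \<Rightarrow> nat fset \<Rightarrow> (nat \<times> nat) set" where
  "inversions I J = {(i, j). i |\<in>| I \<and> j |\<in>| J \<and> j < i}"

text \<open>
  For a family of anticommuting elements \<open>a i\<close> with squares zero, and \<open>a I\<close> the product of the
  \<open>a i\<close>, \<open>i \<in> I\<close>, in increasing order, \<open>a I * a J = shuffle_sgn I J * a (I \<union> J)\<close>.
\<close>
definition shuffle_sgn :: "nat fset \<Rightarrow> nat fset \<Rightarrow> int" where
  "shuffle_sgn I J = (if I |\<inter>| J = {||} then (-1) ^ card (inversions I J) else 0)"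

lemma finite_inversions [simp]: "finite (inversions I J)"
  by (rule finite_subset[of _ "fset I \<times> fset J"]) (auto simp: inversions_def)

lemma shuffle_sgn_empty [simp]: "shuffle_sgn {||} J = 1" "shuffle_sgn I {||} = 1"
  by (simp_all add: shuffle_sgn_def inversions_def)

lemma card_inversions_union_left:
  assumes "I |\<inter>| J = {||}"
  shows "card (inversions (I |\<union>| J) K) = card (inversions I K) + card (inversions J K)"
proof -
  have "inversions (I |\<union>| J) K = inversions I K \<union> inversions J K"
    by (auto simp: inversions_def)
  moreover have "inversions I K \<inter> inversions J K = {}"
    using assms by (auto simp: inversions_def)
  ultimately show ?thesis by (simp add: card_Un_disjoint)
qed

lemma card_inversions_union_right:
  assumes "J |\<inter>| K = {||}"
  shows "card (inversions I (J |\<union>| K)) = card (inversions I J) + card (inversions I K)"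
proof -
  have "inversions I (J |\<union>| K) = inversions I J \<union> inversions I K"
    by (auto simp: inversions_def)
  moreover have "inversions I J \<inter> inversions I K = {}"
    using assms by (auto simp: inversions_def)
  ultimately show ?thesis by (simp add: card_Un_disjoint)
qed

lemma shuffle_sgn_assoc:
  "shuffle_sgn I J * shuffle_sgn (I |\<union>| J) K = shuffle_sgn I (J |\<union>| K) * shuffle_sgn J K"
proof (cases "I |\<inter>| J = {||} \<and> J |\<inter>| K = {||} \<and> I |\<inter>| K = {||}")
  case True
  then show ?thesis
    by (auto simp: shuffle_sgn_def card_inversions_union_left card_inversions_union_right
        power_add inf_sup_distrib1 inf_sup_distrib2)
next
  case False
  then show ?thesis
    by (auto simp: shuffle_sgn_def inf_sup_distrib1 inf_sup_distrib2)
qed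

lemma shuffle_sgn_commute:
  "shuffle_sgn I J = (-1) ^ (fcard I * fcard J) * shuffle_sgn J I"
proof (cases "I |\<inter>| J = {||}")
  case True
  have "fset I \<times> fset J = inversions I J \<union> prod.swap ` inversions J I"
    using True by (force simp: inversions_def image_iff)
  moreover have "inversions I J \<inter> prod.swap ` inversions J I = {}"
    by (auto simp: inversions_def)
  ultimately have "card (fset I \<times> fset J) = card (inversions I J) + card (prod.swap ` inversions J I)"
    by (simp add: card_Un_disjoint)
  also have "card (prod.swap ` inversions J I) = card (inversions J I)"
    by (rule card_image) auto
  finally have "fcard I * fcard J = card (inversions I J) + card (inversions J I)"
    by (simp add: fcard.rep_eq)
  then show ?thesis using True
    by (simp add: shuffle_sgn_def inf_commute power_add)
next
  case False
  then show ?thesis by (auto simp: shuffle_sgn_def inf_commute)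
qed

lemma sum_fibre_assoc:
  fixes h :: "'m \<Rightarrow> 'm \<Rightarrow> 'm \<Rightarrow> 'b::comm_monoid_add"
  assumes assoc: "\<And>a b c. f (f a b) c = f a (f b c)"
    and fin: "\<And>m. finite {(a, b). f a b = m}"
  shows "(\<Sum>(d, c)\<in>{(d, c). f d c = m}. \<Sum>(a, b)\<in>{(a, b). f a b = d}. h a b c) =
         (\<Sum>(a, d)\<in>{(a, d). f a d = m}. \<Sum>(b, c)\<in>{(b, c). f b c = d}. h a b c)"
proof -
  have "(\<Sum>(d, c)\<in>{(d, c). f d c = m}. \<Sum>(a, b)\<in>{(a, b). f a b = d}. h a b c) =
        (\<Sum>(x, y)\<in>(SIGMA x:{(d, c). f d c = m}. {(a, b). f a b = fst x}). h (fst y) (snd y) (snd x))"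
    using fin by (subst sum.Sigma[symmetric]) (auto intro!: sum.cong)
  also have "\<dots> = (\<Sum>(x, y)\<in>(SIGMA x:{(a, d). f a d = m}. {(b, c). f b c = snd x}). h (fst x) (fst y) (snd y))"
    by (rule sum.reindex_bij_witness[
          where i = "\<lambda>((a, d), (b, c)). ((f a b, c), (a, b))"
            and j = "\<lambda>((d, c), (a, b)). ((a, f b c), (b, c))"])
       (auto simp: assoc)
  also have "\<dots> = (\<Sum>(a, d)\<in>{(a, d). f a d = m}. \<Sum>(b, c)\<in>{(b, c). f b c = d}. h a b c)"
    using fin by (subst sum.Sigma[symmetric]) (auto intro!: sum.cong)
  finally show ?thesis .
qed

lemma finite_union_fibre [simp]: "finite {(I, J). I |\<union>| J = (K :: nat fset)}"
proof (rule finite_subset)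
  show "{(I, J). I |\<union>| J = K} \<subseteq> fset (fPow K) \<times> fset (fPow K)" by auto
qed simp

lemma finite_add_fibre [simp]: "finite {(Q, R). Q + R = (T :: nat \<Rightarrow>\<^sub>0 nat)}"
proof -
  define A where "A = {Q. \<forall>i. Poly_Mapping.lookup Q i \<le> Poly_Mapping.lookup T i}"
  have "finite {g. \<forall>i. (i \<in> Poly_Mapping.keys T \<longrightarrow> g i \<in> {..Max (Poly_Mapping.lookup T ` Poly_Mapping.keys T)}) \<and> (i \<notin> Poly_Mapping.keys T \<longrightarrow> g i = 0)}"
    by (intro finite_set_of_finite_funs) auto
  moreover have "Poly_Mapping.lookup ` A \<subseteq> {g. \<forall>i. (i \<in> Poly_Mapping.keys T \<longrightarrow> g i \<in> {..Max (Poly_Mapping.lookup T ` Poly_Mapping.keys T)}) \<and> (i \<notin> Poly_Mapping.keys T \<longrightarrow> g i = 0)}"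
  proof safe
    fix Q i assume Q: "Q \<in> A"
    { assume "i \<in> Poly_Mapping.keys T"
      then have "Poly_Mapping.lookup T i \<le> Max (Poly_Mapping.lookup T ` Poly_Mapping.keys T)" by simp
      moreover have "Poly_Mapping.lookup Q i \<le> Poly_Mapping.lookup T i" using Q by (simp add: A_def)
      ultimately show "Poly_Mapping.lookup Q i \<le> Max (Poly_Mapping.lookup T ` Poly_Mapping.keys T)" by linarith }
    { assume "i \<notin> Poly_Mapping.keys T"
      then have "Poly_Mapping.lookup T i = 0" by (simp add: in_keys_iff)
      moreover have "Poly_Mapping.lookup Q i \<le> Poly_Mapping.lookup T i" using Q by (simp add: A_def)
      ultimately show "Poly_Mapping.lookup Q i = 0" by simp }
  qed
  ultimately have "finite (Poly_Mapping.lookup ` A)" by (rule finite_subset[rotated])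
  then have "finite A" by (rule finite_imageD) (simp add: inj_on_def lookup_inject)
  moreover have "{(Q, R). Q + R = T} \<subseteq> A \<times> A" by (auto simp: A_def lookup_add)
  ultimately show ?thesis by (meson finite_SigmaI finite_subset)
qed


section \<open>The algebra \<open>E(x\<^sub>0, x\<^sub>1, \<dots>) \<otimes> P(y\<^sub>0, y\<^sub>1, \<dots>)\<close>\<close>

text \<open>
  All generators \<open>x i\<close>, \<open>y i\<close> with \<open>i :: nat\<close> are kept in one type; the cohomology of
  \<open>B(Z/p)^n\<close> is the subalgebra generated by those with \<open>1 \<le> i \<le> n\<close>.
  An element is written uniquely as the finite sum of the \<open>x I * ecoef u I\<close>, where \<open>x I\<close> is the
  increasing product of the \<open>x i\<close>, \<open>i \<in> I\<close>, and \<open>ecoef u I\<close> is a polynomial in the \<open>y i\<close>.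
\<close>

type_synonym 'a ypoly = "(nat \<Rightarrow>\<^sub>0 nat) \<Rightarrow>\<^sub>0 'a"

definition yvar :: "nat \<Rightarrow> 'a::comm_ring_1 ypoly" where
  "yvar i = Poly_Mapping.single (Poly_Mapping.single i 1) 1"

typedef (overloaded) 'a coh = "{u :: nat fset \<Rightarrow> ('a::zero) ypoly. finite {I. u I \<noteq> 0}}"
  morphisms ecoef Abs_coh
  by (rule exI[of _ "\<lambda>_. 0"]) simp

lemma finite_ecoef [simp]: "finite {I. ecoef u I \<noteq> 0}"
  using ecoef by auto

lemma coh_eqI: "(\<And>I. ecoef u I = ecoef v I) \<Longrightarrow> u = v"
  by (simp add: ecoef_inject[symmetric] fun_eq_iff)

instantiation coh :: (comm_ring_1) ab_group_add
begin

definition zero_coh :: "'a coh" where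
  "0 = Abs_coh (\<lambda>I. 0)"

definition plus_coh :: "'a coh \<Rightarrow> 'a coh \<Rightarrow> 'a coh" where
  "u + v = Abs_coh (\<lambda>I. ecoef u I + ecoef v I)"

definition uminus_coh :: "'a coh \<Rightarrow> 'a coh" where
  "- u = Abs_coh (\<lambda>I. - ecoef u I)"

definition minus_coh :: "'a coh \<Rightarrow> 'a coh \<Rightarrow> 'a coh" where
  "u - v = Abs_coh (\<lambda>I. ecoef u I - ecoef v I)"

lemma ecoef_zero [simp]: "ecoef 0 I = 0"
  by (simp add: zero_coh_def Abs_coh_inverse)

lemma ecoef_plus [simp]: "ecoef (u + v) I = ecoef u I + ecoef v I"
proof -
  have "finite {I. ecoef u I + ecoef v I \<noteq> 0}"
    by (rule finite_subset[of _ "{I. ecoef u I \<noteq> 0} \<union> {I. ecoef v I \<noteq> 0}"]) auto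
  then show ?thesis by (simp add: plus_coh_def Abs_coh_inverse)
qed

lemma ecoef_uminus [simp]: "ecoef (- u) I = - ecoef u I"
  by (simp add: uminus_coh_def Abs_coh_inverse)

lemma ecoef_minus [simp]: "ecoef (u - v) I = ecoef u I - ecoef v I"
proof -
  have "finite {I. ecoef u I - ecoef v I \<noteq> 0}"
    by (rule finite_subset[of _ "{I. ecoef u I \<noteq> 0} \<union> {I. ecoef v I \<noteq> 0}"]) auto
  then show ?thesis by (simp add: minus_coh_def Abs_coh_inverse)
qed

instance by standard (rule coh_eqI, simp add: algebra_simps)+

end

lemma ecoef_sum [simp]: "ecoef (sum f A) I = (\<Sum>a\<in>A. ecoef (f a) I)"
  by (induction A rule: infinite_finite_induct) simp_all

instantiation coh :: (comm_ring_1) ring_1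
begin

definition one_coh :: "'a coh" where
  "1 = Abs_coh (\<lambda>I. if I = {||} then 1 else 0)"

definition times_coh :: "'a coh \<Rightarrow> 'a coh \<Rightarrow> 'a coh" where
  "u * v = Abs_coh (\<lambda>K. \<Sum>(I, J)\<in>{(I, J). I |\<union>| J = K}.
     of_int (shuffle_sgn I J) * ecoef u I * ecoef v J)"

lemma ecoef_one [simp]: "ecoef 1 I = (if I = {||} then 1 else 0)"
  by (simp add: one_coh_def Abs_coh_inverse)

lemma ecoef_times:
  "ecoef (u * v) K = (\<Sum>(I, J)\<in>{(I, J). I |\<union>| J = K}. of_int (shuffle_sgn I J) * ecoef u I * ecoef v J)"
proof -
  let ?S = "\<lambda>K. \<Sum>(I, J)\<in>{(I, J). I |\<union>| J = K}. of_int (shuffle_sgn I J) * ecoef u I * ecoef v J"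
  have "{K. ?S K \<noteq> 0} \<subseteq> (\<lambda>(I, J). I |\<union>| J) ` ({I. ecoef u I \<noteq> 0} \<times> {I. ecoef v I \<noteq> 0})"
  proof
    fix K assume "K \<in> {K. ?S K \<noteq> 0}"
    then have "?S K \<noteq> 0" by simp
    then obtain x where x: "x \<in> {(I, J). I |\<union>| J = K}"
        "(case x of (I, J) \<Rightarrow> of_int (shuffle_sgn I J) * ecoef u I * ecoef v J) \<noteq> 0"
      by (rule sum.not_neutral_contains_not_neutral)
    then have "ecoef u (fst x) \<noteq> 0" "ecoef v (snd x) \<noteq> 0" by (auto simp: split_def)
    then show "K \<in> (\<lambda>(I, J). I |\<union>| J) ` ({I. ecoef u I \<noteq> 0} \<times> {I. ecoef v I \<noteq> 0})"
      using x(1) by (intro image_eqI[of _ _ x]) (auto simp: split_def mem_Times_iff)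
  qed
  then have "finite {K. ?S K \<noteq> 0}"
    by (rule finite_subset) (intro finite_imageI finite_SigmaI finite_ecoef)
  then show ?thesis by (simp add: times_coh_def Abs_coh_inverse)
qed

instance
proof
  fix u v w :: "'a coh"
  show "u * v * w = u * (v * w)"
  proof (rule coh_eqI)
    fix K
    let ?s = "\<lambda>I J. of_int (shuffle_sgn I J) :: 'a ypoly"
    have s: "?s (I |\<union>| J) K * (?s I J * a) = ?s I (J |\<union>| K) * (?s J K * a)" for I J K a
      using shuffle_sgn_assoc[of I J K]
      by (metis (no_types, lifting) mult.assoc mult.commute of_int_mult)
    have "ecoef (u * v * w) K = (\<Sum>(I, J)\<in>{(I, J). I |\<union>| J = K}. \<Sum>(I', J')\<in>{(I', J'). I' |\<union>| J' = I}.
            ?s (I' |\<union>| J') J * (?s I' J' * (ecoef u I' * ecoef v J' * ecoef w J)))"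
      unfolding ecoef_times
      by (intro sum.cong refl) (auto simp: sum_distrib_left sum_distrib_right mult_ac intro!: sum.cong)
    also have "\<dots> = (\<Sum>(I', J)\<in>{(I', J). I' |\<union>| J = K}. \<Sum>(J', L)\<in>{(J', L). J' |\<union>| L = J}.
            ?s (I' |\<union>| J') L * (?s I' J' * (ecoef u I' * ecoef v J' * ecoef w L)))"
      by (rule sum_fibre_assoc[where f = "(|\<union>|)" and m = K
            and h = "\<lambda>I' J' L. ?s (I' |\<union>| J') L * (?s I' J' * (ecoef u I' * ecoef v J' * ecoef w L))"])
         (simp_all add: sup_assoc)
    also have "\<dots> = ecoef (u * (v * w)) K"
      unfolding s ecoef_times
      by (intro sum.cong refl) (auto simp: sum_distrib_left sum_distrib_right mult_ac intro!: sum.cong)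
    finally show "ecoef (u * v * w) K = ecoef (u * (v * w)) K" .
  qed
  show "(u + v) * w = u * w + v * w" "u * (v + w) = u * v + u * w"
    by (rule coh_eqI, unfold ecoef_times ecoef_plus sum.distrib[symmetric],
        rule sum.cong, simp, simp add: algebra_simps split_def)+
  show "1 * u = u"
  proof (rule coh_eqI)
    fix K
    have "ecoef (1 * u) K = (\<Sum>(I, J)\<in>{({||}, K)}. of_int (shuffle_sgn I J) * ecoef 1 I * ecoef u J)"
      unfolding ecoef_times by (rule sum.mono_neutral_right) (auto split: if_splits)
    then show "ecoef (1 * u) K = ecoef u K" by simp
  qed
  show "u * 1 = u"
  proof (rule coh_eqI)
    fix K
    have "ecoef (u * 1) K = (\<Sum>(I, J)\<in>{(K, {||})}. of_int (shuffle_sgn I J) * ecoef u I * ecoef 1 J)"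
      unfolding ecoef_times by (rule sum.mono_neutral_right) (auto split: if_splits)
    then show "ecoef (u * 1) K = ecoef u K" by simp
  qed
  have "ecoef (0 :: 'a coh) {||} \<noteq> ecoef 1 {||}" by simp
  then show "(0 :: 'a coh) \<noteq> 1" by metis
qed

end

text \<open>\<open>hmono I f\<close> is the element \<open>x I * f\<close>.\<close>
definition hmono :: "nat fset \<Rightarrow> 'a::comm_ring_1 ypoly \<Rightarrow> 'a coh" where
  "hmono I f = Abs_coh (\<lambda>J. if J = I then f else 0)"

definition hpoly :: "'a::comm_ring_1 ypoly \<Rightarrow> 'a coh" where
  "hpoly f = hmono {||} f"

definition xgen :: "nat \<Rightarrow> 'a::comm_ring_1 coh" where
  "xgen i = hmono {|i|} 1"

definition ygen :: "nat \<Rightarrow> 'a::comm_ring_1 coh" where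
  "ygen i = hpoly (yvar i)"

lemma ecoef_hmono [simp]: "ecoef (hmono I f) J = (if J = I then f else 0)"
  by (simp add: hmono_def Abs_coh_inverse)

lemma hmono_mult: "hmono I f * hmono J g = hmono (I |\<union>| J) (of_int (shuffle_sgn I J) * f * g)"
proof (rule coh_eqI)
  fix K
  have "ecoef (hmono I f * hmono J g) K =
        (\<Sum>(I', J')\<in>{(I', J'). I' |\<union>| J' = K} \<inter> {(I, J)}. of_int (shuffle_sgn I' J') * f * g)"
    unfolding ecoef_times by (rule sum.mono_neutral_cong_right) (auto split: if_splits)
  also have "\<dots> = ecoef (hmono (I |\<union>| J) (of_int (shuffle_sgn I J) * f * g)) K"
    by (cases "I |\<union>| J = K") auto
  finally show "ecoef (hmono I f * hmono J g) K = ecoef (hmono (I |\<union>| J) (of_int (shuffle_sgn I J) * f * g)) K" .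
qed

lemma hmono_zero [simp]: "hmono I 0 = 0" by (rule coh_eqI) simp
lemma hmono_add: "hmono I (f + g) = hmono I f + hmono I g" by (rule coh_eqI) simp
lemma hpoly_0 [simp]: "hpoly 0 = 0" by (simp add: hpoly_def)
lemma hpoly_1 [simp]: "hpoly 1 = 1" by (rule coh_eqI) (simp add: hpoly_def)
lemma hpoly_add: "hpoly (f + g) = hpoly f + hpoly g" by (simp add: hpoly_def hmono_add)
lemma hpoly_mult: "hpoly (f * g) = hpoly f * hpoly g" by (simp add: hpoly_def hmono_mult)
lemma hpoly_power: "hpoly (f ^ m) = hpoly f ^ m" by (induction m) (simp_all add: hpoly_mult)

lemma coh_expand: "u = (\<Sum>I | ecoef u I \<noteq> 0. hmono I (ecoef u I))"
  by (rule coh_eqI) (auto simp: sum.delta')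

lemma xgen_anticommute: "xgen i * xgen j = - (xgen j * (xgen i :: 'a::comm_ring_1 coh))"
proof (cases "i = j")
  case True
  then show ?thesis by (simp add: xgen_def hmono_mult shuffle_sgn_def)
next
  case False
  then show ?thesis
    using shuffle_sgn_commute[of "{|i|}" "{|j|}"]
    by (intro coh_eqI) (simp add: xgen_def hmono_mult sup_commute fcard.rep_eq)
qed

lemma xgen_square: "xgen i * xgen i = 0"
  by (simp add: xgen_def hmono_mult shuffle_sgn_def)

lemma ygen_commute: "ygen i * u = u * ygen i"
proof -
  have "ygen i * (\<Sum>I | ecoef u I \<noteq> 0. hmono I (ecoef u I)) = (\<Sum>I | ecoef u I \<noteq> 0. hmono I (ecoef u I)) * ygen i"
    unfolding sum_distrib_left sum_distrib_right
    by (intro sum.cong refl) (simp add: ygen_def hpoly_def hmono_mult mult.commute)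
  then show ?thesis by (simp flip: coh_expand)
qed


lemma of_int_coh: "of_int m = hpoly (of_int m)"
proof (rule coh_eqI)
  fix I
  have "ecoef (of_nat k) I = (if I = {||} then of_nat k else (0 :: 'a ypoly))" for k
    by (induction k) (simp_all add: algebra_simps)
  then show "ecoef (of_int m) I = ecoef (hpoly (of_int m) :: 'a coh) I"
    by (cases m rule: int_diff_cases) (simp add: hpoly_def)
qed

lemma ecoef_of_int_mult [simp]: "ecoef (of_int m * u) I = of_int m * ecoef u I"
proof -
  have "of_int m * (\<Sum>I | ecoef u I \<noteq> 0. hmono I (ecoef u I)) = (\<Sum>I | ecoef u I \<noteq> 0. hmono I (of_int m * ecoef u I))"
    by (simp add: sum_distrib_left of_int_coh hpoly_def hmono_mult)
  then have "ecoef (of_int m * u) I = ecoef (\<Sum>I | ecoef u I \<noteq> 0. hmono I (of_int m * ecoef u I)) I"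
    by (simp flip: coh_expand)
  then show ?thesis by (auto simp: sum.delta')
qed

lemma of_int_shift: "x * (of_int m * y) = of_int m * (x * (y :: 'r::ring_1))"
  by (metis mult.assoc mult_of_int_commute)

lemma of_int_of_int: "of_int a * (of_int b * y) = of_int (a * b) * (y :: 'r::ring_1)"
  by (simp add: mult.assoc)

text \<open>\<open>twist t v\<close> is \<open>(-1) ^ (t * dim v) * v\<close> for homogeneous \<open>v\<close>, since \<open>dim (x I * f) \<equiv> |I|\<close> mod 2.\<close>
definition twist :: "nat \<Rightarrow> 'a::comm_ring_1 coh \<Rightarrow> 'a coh" where
  "twist t v = Abs_coh (\<lambda>I. (-1) ^ (t * fcard I) * ecoef v I)"

lemma ecoef_twist [simp]: "ecoef (twist t v) I = (-1) ^ (t * fcard I) * ecoef v I"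
proof -
  have "finite {I. (-1) ^ (t * fcard I) * ecoef v I \<noteq> 0}"
    by (rule finite_subset[of _ "{I. ecoef v I \<noteq> 0}"]) auto
  then show ?thesis by (simp add: twist_def Abs_coh_inverse)
qed

lemma twist_0 [simp]: "twist 0 u = u" by (rule coh_eqI) simp
lemma twist_zero [simp]: "twist t 0 = 0" by (rule coh_eqI) simp
lemma twist_one [simp]: "twist t 1 = 1" by (rule coh_eqI) (simp add: fcard.rep_eq)
lemma twist_hpoly [simp]: "twist t (hpoly f) = hpoly f" by (rule coh_eqI) (simp add: hpoly_def fcard.rep_eq)
lemma twist_of_int [simp]: "twist t (of_int m) = of_int m" by (simp add: of_int_coh)
lemma twist_add: "twist t (u + v) = twist t u + twist t v" by (rule coh_eqI) (simp add: algebra_simps)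
lemma twist_sum: "twist t (sum f A) = (\<Sum>a\<in>A. twist t (f a))"
  by (induction A rule: infinite_finite_induct) (simp_all add: twist_add)
lemma twist_twist: "twist s (twist t u) = twist (s + t) u"
  by (rule coh_eqI) (simp add: power_add algebra_simps)

lemma twist_mult: "twist t (u * v) = twist t u * twist t v"
proof (rule coh_eqI)
  fix K
  have *: "(-1) ^ (t * fcard (I |\<union>| J)) * (of_int (shuffle_sgn I J) * a * b) =
        of_int (shuffle_sgn I J) * ((-1) ^ (t * fcard I) * a) * ((-1) ^ (t * fcard J) * (b :: 'a ypoly))" for I J a b
  proof (cases "I |\<inter>| J = {||}")
    case True
    then have "fcard (I |\<union>| J) = fcard I + fcard J" by (rule fcard_funion_disjoint)
    then show ?thesis by (simp add: algebra_simps power_add)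
  next
    case False
    then show ?thesis by (simp add: shuffle_sgn_def)
  qed
  show "ecoef (twist t (u * v)) K = ecoef (twist t u * twist t v) K"
    unfolding ecoef_times ecoef_twist sum_distrib_left
    by (rule sum.cong) (auto simp flip: *)
qed


section \<open>The completed tensor product with the dual Steenrod algebra\<close>

text \<open>
  The dual Steenrod algebra is \<open>E(\<tau>\<^sub>0, \<tau>\<^sub>1, \<dots>) \<otimes> P(\<xi>\<^sub>1, \<xi>\<^sub>2, \<dots>)\<close>. The basis monomial \<open>\<tau>\<^sub>S \<xi>\<^sup>R\<close> is
  indexed by the pair \<open>(S, R)\<close>, where the exponent of \<open>\<xi>\<^sub>i\<close> is the value of \<open>R\<close> at \<open>i - 1\<close>; thus
  the sequence \<open>(r\<^sub>1, \<dots>, r\<^sub>m)\<close> is the exponent \<open>Poly_Mapping.nth [r\<^sub>1, \<dots>, r\<^sub>m]\<close>. As there are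
  finitely many monomials in every degree, an element of the completed tensor product is an
  arbitrary family of coefficients \<open>tcoef f (S, R)\<close>, standing for the formal sum of the
  \<open>tcoef f (S, R) \<otimes> \<tau>\<^sub>S \<xi>\<^sup>R\<close>.
\<close>

type_synonym milnor_index = "nat fset \<times> (nat \<Rightarrow>\<^sub>0 nat)"

typedef (overloaded) 'a tens = "UNIV :: (milnor_index \<Rightarrow> ('a::zero) coh) set"
  morphisms tcoef Abs_tens by simp

lemma tcoef_Abs_tens [simp]: "tcoef (Abs_tens f) m = f m"
  by (simp add: Abs_tens_inverse)

lemma tens_eqI: "(\<And>m. tcoef f m = tcoef g m) \<Longrightarrow> f = g"
  by (simp add: tcoef_inject[symmetric] fun_eq_iff)

instantiation tens :: (comm_ring_1) ab_group_add
begin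

definition zero_tens :: "'a tens" where "0 = Abs_tens (\<lambda>m. 0)"
definition plus_tens :: "'a tens \<Rightarrow> 'a tens \<Rightarrow> 'a tens" where
  "f + g = Abs_tens (\<lambda>m. tcoef f m + tcoef g m)"
definition uminus_tens :: "'a tens \<Rightarrow> 'a tens" where
  "- f = Abs_tens (\<lambda>m. - tcoef f m)"
definition minus_tens :: "'a tens \<Rightarrow> 'a tens \<Rightarrow> 'a tens" where
  "f - g = Abs_tens (\<lambda>m. tcoef f m - tcoef g m)"

lemma tcoef_zero [simp]: "tcoef 0 m = 0" by (simp add: zero_tens_def)
lemma tcoef_plus [simp]: "tcoef (f + g) m = tcoef f m + tcoef g m" by (simp add: plus_tens_def)
lemma tcoef_uminus [simp]: "tcoef (- f) m = - tcoef f m" by (simp add: uminus_tens_def)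
lemma tcoef_minus [simp]: "tcoef (f - g) m = tcoef f m - tcoef g m" by (simp add: minus_tens_def)

instance by standard (rule tens_eqI, simp add: algebra_simps)+

end

lemma tcoef_sum [simp]: "tcoef (sum f A) m = (\<Sum>a\<in>A. tcoef (f a) m)"
  by (induction A rule: infinite_finite_induct) simp_all

definition idx_add :: "milnor_index \<Rightarrow> milnor_index \<Rightarrow> milnor_index" where
  "idx_add a b = (fst a |\<union>| fst b, snd a + snd b)"

definition idx_sgn :: "milnor_index \<Rightarrow> milnor_index \<Rightarrow> int" where
  "idx_sgn a b = shuffle_sgn (fst a) (fst b)"

lemma idx_add_assoc: "idx_add (idx_add a b) c = idx_add a (idx_add b c)"
  by (simp add: idx_add_def sup_assoc add.assoc)

lemma finite_idx_fibre [simp]: "finite {(a, b). idx_add a b = m}"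
proof (rule finite_subset)
  show "{(a, b). idx_add a b = m} \<subseteq> (\<lambda>((S, S'), (R, R')). ((S, R), (S', R'))) `
      ({(S, S'). S |\<union>| S' = fst m} \<times> {(R, R'). R + R' = snd m})"
    by (force simp: idx_add_def image_iff)
qed (intro finite_imageI finite_SigmaI finite_union_fibre finite_add_fibre)

instantiation tens :: (comm_ring_1) ring_1
begin

definition one_tens :: "'a tens" where
  "1 = Abs_tens (\<lambda>m. if m = ({||}, 0) then 1 else 0)"

text \<open>
  The Koszul rule is \<open>(u \<otimes> \<tau>\<^sub>S \<xi>\<^sup>R) (v \<otimes> \<tau>\<^sub>S\<^sub>' \<xi>\<^sup>R\<^sup>') = (-1) ^ (|S| dim v) u v \<otimes> \<tau>\<^sub>S \<xi>\<^sup>R \<tau>\<^sub>S\<^sub>' \<xi>\<^sup>R\<^sup>'\<close>,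
  the \<open>\<tau>\<^sub>s\<close> having odd and the \<open>\<xi>\<^sub>i\<close> even degree.
\<close>
definition times_tens :: "'a tens \<Rightarrow> 'a tens \<Rightarrow> 'a tens" where
  "f * g = Abs_tens (\<lambda>m. \<Sum>(a, b)\<in>{(a, b). idx_add a b = m}.
     of_int (idx_sgn a b) * (tcoef f a * twist (fcard (fst a)) (tcoef g b)))"

lemma tcoef_one [simp]: "tcoef 1 m = (if m = ({||}, 0) then 1 else 0)"
  by (simp add: one_tens_def)

lemma tcoef_times: "tcoef (f * g) m = (\<Sum>(a, b)\<in>{(a, b). idx_add a b = m}.
     of_int (idx_sgn a b) * (tcoef f a * twist (fcard (fst a)) (tcoef g b)))"
  by (simp add: times_tens_def)

instance
proof
  fix f g h :: "'a tens"
  show "f * g * h = f * (g * h)"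
  proof (rule tens_eqI)
    fix m
    let ?s = "\<lambda>a b. of_int (idx_sgn a b) :: 'a coh"
    let ?t = "\<lambda>a u. twist (fcard (fst a)) u"
    let ?h1 = "\<lambda>a b c. of_int (idx_sgn (idx_add a b) c * idx_sgn a b) *
        (tcoef f a * (?t a (tcoef g b) * ?t (idx_add a b) (tcoef h c)))"
    let ?h2 = "\<lambda>a b c. of_int (idx_sgn a (idx_add b c) * idx_sgn b c) *
        (tcoef f a * (?t a (tcoef g b) * ?t a (?t b (tcoef h c))))"
    have h: "?h1 a b c = ?h2 a b c" for a b c
    proof -
      have s: "idx_sgn (idx_add a b) c * idx_sgn a b = idx_sgn a (idx_add b c) * idx_sgn b c"
        using shuffle_sgn_assoc[of "fst a" "fst b" "fst c"]
        by (simp add: idx_sgn_def idx_add_def mult.commute)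
      show ?thesis
      proof (cases "fst a |\<inter>| fst b = {||}")
        case True
        then have "fcard (fst (idx_add a b)) = fcard (fst a) + fcard (fst b)"
          by (simp add: idx_add_def fcard_funion_disjoint)
        then show ?thesis using s by (simp add: twist_twist)
      next
        case False
        then have "idx_sgn a b = 0" by (simp add: idx_sgn_def shuffle_sgn_def)
        then have "of_int (idx_sgn (idx_add a b) c * idx_sgn a b) = (0 :: 'a coh)"
            "of_int (idx_sgn a (idx_add b c) * idx_sgn b c) = (0 :: 'a coh)"
          using s by auto
        then show ?thesis by (metis mult_zero_left)
      qed
    qed
    have "tcoef (f * g * h) m = (\<Sum>(d, c)\<in>{(d, c). idx_add d c = m}. \<Sum>(a, b)\<in>{(a, b). idx_add a b = d}. ?h1 a b c)"
      unfolding tcoef_times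
      by (intro sum.cong refl)
        (auto simp: sum_distrib_left sum_distrib_right mult.assoc of_int_of_int simp del: of_int_mult
          intro!: sum.cong)
    also have "\<dots> = (\<Sum>(a, d)\<in>{(a, d). idx_add a d = m}. \<Sum>(b, c)\<in>{(b, c). idx_add b c = d}. ?h1 a b c)"
      by (rule sum_fibre_assoc[where f = idx_add and m = m and h = ?h1]) (simp_all add: idx_add_assoc)
    also have "\<dots> = tcoef (f * (g * h)) m"
      unfolding tcoef_times h
      by (intro sum.cong refl)
        (auto simp: sum_distrib_left mult.assoc twist_sum twist_mult split_def
            of_int_shift[of "tcoef f _"] of_int_of_int simp del: of_int_mult intro!: sum.cong)
    finally show "tcoef (f * g * h) m = tcoef (f * (g * h)) m" .
  qed
  show "(f + g) * h = f * h + g * h" "f * (g + h) = f * g + f * h"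
    by (rule tens_eqI, unfold tcoef_times tcoef_plus sum.distrib[symmetric],
        rule sum.cong, simp, simp add: algebra_simps twist_add split_def)+
  show "1 * f = f"
  proof (rule tens_eqI)
    fix m :: milnor_index
    have "tcoef (1 * f) m = (\<Sum>(a, b)\<in>{(({||}, 0), m)}.
        of_int (idx_sgn a b) * (tcoef 1 a * twist (fcard (fst a)) (tcoef f b)))"
      unfolding tcoef_times
      by (rule sum.mono_neutral_right[OF finite_idx_fibre]) (auto simp: idx_add_def split: if_splits)
    then show "tcoef (1 * f) m = tcoef f m" by (simp add: idx_sgn_def fcard.rep_eq)
  qed
  show "f * 1 = f"
  proof (rule tens_eqI)
    fix m :: milnor_index
    have "tcoef (f * 1) m = (\<Sum>(a, b)\<in>{(m, ({||}, 0))}.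
        of_int (idx_sgn a b) * (tcoef f a * twist (fcard (fst a)) (tcoef 1 b)))"
      unfolding tcoef_times
      by (rule sum.mono_neutral_right[OF finite_idx_fibre]) (auto simp: idx_add_def split: if_splits)
    then show "tcoef (f * 1) m = tcoef f m" by (simp add: idx_sgn_def)
  qed
  have "tcoef (0 :: 'a tens) ({||}, 0) \<noteq> tcoef 1 ({||}, 0)" by simp
  then show "(0 :: 'a tens) \<noteq> 1" by metis
qed

end


text \<open>\<open>tmono S R u\<close> is \<open>u \<otimes> \<tau>\<^sub>S \<xi>\<^sup>R\<close>.\<close>
definition tmono :: "nat fset \<Rightarrow> (nat \<Rightarrow>\<^sub>0 nat) \<Rightarrow> 'a::comm_ring_1 coh \<Rightarrow> 'a tens" where
  "tmono S R u = Abs_tens (\<lambda>m. if m = (S, R) then u else 0)"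

text \<open>Convergent sums; only applied when every coefficient is a finite sum.\<close>
definition tsum :: "(nat \<Rightarrow> 'a::comm_ring_1 tens) \<Rightarrow> 'a tens" where
  "tsum f = Abs_tens (\<lambda>m. Sum_any (\<lambda>s. tcoef (f s) m))"

lemma tcoef_tmono [simp]: "tcoef (tmono S R u) m = (if m = (S, R) then u else 0)"
  by (simp add: tmono_def)

lemma tmono_mult:
  "tmono S R u * tmono S' R' v =
   tmono (S |\<union>| S') (R + R') (of_int (shuffle_sgn S S') * (u * twist (fcard S) v))"
proof (rule tens_eqI)
  fix m
  have "tcoef (tmono S R u * tmono S' R' v) m =
        (\<Sum>(a, b)\<in>{(a, b). idx_add a b = m} \<inter> {((S, R), (S', R'))}.
          of_int (idx_sgn a b) * (u * twist (fcard (fst a)) v))"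
    unfolding tcoef_times by (rule sum.mono_neutral_cong_right) (auto split: if_splits)
  also have "\<dots> = tcoef (tmono (S |\<union>| S') (R + R') (of_int (shuffle_sgn S S') * (u * twist (fcard S) v))) m"
    by (cases "idx_add (S, R) (S', R') = m") (auto simp: idx_add_def idx_sgn_def)
  finally show "tcoef (tmono S R u * tmono S' R' v) m = \<dots>" .
qed


subsection \<open>Parity\<close>

definition coh_parity :: "nat \<Rightarrow> 'a::comm_ring_1 coh \<Rightarrow> bool" where
  "coh_parity e u \<longleftrightarrow> (\<forall>I. ecoef u I \<noteq> 0 \<longrightarrow> even (fcard I + e))"

definition tens_parity :: "nat \<Rightarrow> 'a::comm_ring_1 tens \<Rightarrow> bool" where
  "tens_parity e f \<longleftrightarrow> (\<forall>m. coh_parity (fcard (fst m) + e) (tcoef f m))"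

lemma minus_one_power_cong: "even (m + n) \<Longrightarrow> (-1) ^ m = ((-1) ^ n :: 'r::ring_1)"
  by (cases "even m") auto

lemma coh_parity_0 [simp]: "coh_parity e 0" by (simp add: coh_parity_def)

lemma coh_parity_hpoly: "even e \<Longrightarrow> coh_parity e (hpoly f)"
  by (auto simp: coh_parity_def hpoly_def fcard.rep_eq)

lemma coh_parity_xgen: "odd e \<Longrightarrow> coh_parity e (xgen i)"
  by (auto simp: coh_parity_def xgen_def fcard.rep_eq)

lemma coh_parity_add: "coh_parity e u \<Longrightarrow> coh_parity e v \<Longrightarrow> coh_parity e (u + v)"
  unfolding coh_parity_def ecoef_plus by (metis add.right_neutral)

lemma coh_parity_sum: "(\<And>a. a \<in> A \<Longrightarrow> coh_parity e (f a)) \<Longrightarrow> coh_parity e (sum f A)"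
  by (induction A rule: infinite_finite_induct) (auto intro: coh_parity_add)

lemma twist_parity: "coh_parity e u \<Longrightarrow> twist t u = of_int ((-1) ^ (t * e)) * u"
proof (rule coh_eqI)
  fix I assume "coh_parity e u"
  then have "ecoef u I \<noteq> 0 \<Longrightarrow> (-1) ^ (t * fcard I) = ((-1) ^ (t * e) :: 'a ypoly)"
    by (intro minus_one_power_cong) (auto simp: coh_parity_def simp flip: distrib_left)
  then show "ecoef (twist t u) I = ecoef (of_int ((-1) ^ (t * e)) * u) I"
    unfolding ecoef_of_int_mult by (cases "ecoef u I = 0") auto
qed

lemma coh_commute:
  assumes "coh_parity a u" "coh_parity b v"
  shows "u * v = of_int ((-1) ^ (a * b)) * (v * u)"
proof (rule coh_eqI)
  fix K
  have *: "of_int (shuffle_sgn I J) * ecoef u I * ecoef v J =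
        of_int ((-1) ^ (a * b)) * (of_int (shuffle_sgn J I) * ecoef v J * ecoef u I)" for I J
  proof (cases "ecoef u I = 0 \<or> ecoef v J = 0")
    case False
    then have "even (fcard I + a)" "even (fcard J + b)"
      using assms by (auto simp: coh_parity_def)
    then have "(-1) ^ (fcard I * fcard J) = ((-1) ^ (a * b) :: int)"
      by (intro minus_one_power_cong) auto
    then show ?thesis using shuffle_sgn_commute[of I J] by (simp add: mult_ac)
  qed auto
  have "ecoef (u * v) K = (\<Sum>(I, J)\<in>{(I, J). I |\<union>| J = K}.
          of_int ((-1) ^ (a * b)) * (of_int (shuffle_sgn J I) * ecoef v J * ecoef u I))"
    unfolding ecoef_times by (simp only: *)
  also have "\<dots> = (\<Sum>(J, I)\<in>{(J, I). J |\<union>| I = K}.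
          of_int ((-1) ^ (a * b)) * (of_int (shuffle_sgn J I) * ecoef v J * ecoef u I))"
    by (rule sum.reindex_bij_witness[of _ prod.swap prod.swap]) auto
  also have "\<dots> = ecoef (of_int ((-1) ^ (a * b)) * (v * u)) K"
    unfolding ecoef_of_int_mult unfolding ecoef_times sum_distrib_left by (simp add: split_def)
  finally show "ecoef (u * v) K = ecoef (of_int ((-1) ^ (a * b)) * (v * u)) K" .
qed

lemma of_int_tens: "of_int m = tmono {||} 0 (of_int m)"
proof (rule tens_eqI)
  fix i
  have "tcoef (of_nat k) i = (if i = ({||}, 0) then of_nat k else (0 :: 'a coh))" for k
    by (induction k) simp_all
  then show "tcoef (of_int m) i = tcoef (tmono {||} 0 (of_int m) :: 'a tens) i"
    by (cases m rule: int_diff_cases) simp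
qed

lemma tcoef_tmono0_mult: "tcoef (tmono {||} 0 u * f) m = u * tcoef f m"
proof -
  have "tcoef (tmono {||} 0 u * f) m = (\<Sum>(a, b)\<in>{(({||}, 0), m)}.
      of_int (idx_sgn a b) * (tcoef (tmono {||} 0 u) a * twist (fcard (fst a)) (tcoef f b)))"
    unfolding tcoef_times
    by (rule sum.mono_neutral_right[OF finite_idx_fibre]) (auto simp: idx_add_def split: if_splits)
  then show ?thesis by (simp add: idx_sgn_def fcard.rep_eq)
qed

lemma tcoef_of_int_mult: "tcoef (of_int k * f) m = of_int k * tcoef f m"
  by (simp add: of_int_tens tcoef_tmono0_mult)

lemma tens_commute:
  assumes "tens_parity a f" "tens_parity b g"
  shows "f * g = of_int ((-1) ^ (a * b)) * (g * f)"
proof (rule tens_eqI)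
  fix m
  let ?A = "{(c, d). idx_add c d = m}"
  have *: "of_int (idx_sgn c d) * (tcoef f c * twist (fcard (fst c)) (tcoef g d)) =
        of_int ((-1) ^ (a * b)) *
          (of_int (idx_sgn d c) * (tcoef g d * twist (fcard (fst d)) (tcoef f c)))" for c d
  proof -
    define s t where "s = fcard (fst c)" and "t = fcard (fst d)"
    have f: "coh_parity (s + a) (tcoef f c)" and g: "coh_parity (t + b) (tcoef g d)"
      using assms unfolding tens_parity_def s_def t_def by blast+
    let ?u = "tcoef g d * tcoef f c"
    have "(-1) ^ (s * t + s * (t + b) + (s + a) * (t + b)) = ((-1) ^ (a * b + t * (s + a)) :: int)"
      by (rule minus_one_power_cong) (auto simp: algebra_simps)
    moreover have "idx_sgn c d = (-1) ^ (s * t) * idx_sgn d c"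
      unfolding idx_sgn_def s_def t_def by (rule shuffle_sgn_commute)
    ultimately have sgn: "idx_sgn c d * ((-1) ^ (s * (t + b)) * (-1) ^ ((s + a) * (t + b))) =
        (-1) ^ (a * b) * (idx_sgn d c * (-1) ^ (t * (s + a)))"
      by (simp add: power_add mult_ac)
    have "of_int (idx_sgn c d) * (tcoef f c * twist s (tcoef g d)) =
        of_int (idx_sgn c d * ((-1) ^ (s * (t + b)) * (-1) ^ ((s + a) * (t + b)))) * ?u"
      unfolding twist_parity[OF g] of_int_shift[of "tcoef f c"] coh_commute[OF f g] of_int_of_int ..
    also have "\<dots> = of_int ((-1) ^ (a * b)) * (of_int (idx_sgn d c) * (tcoef g d * twist t (tcoef f c)))"
      unfolding sgn twist_parity[OF f] of_int_shift[of "tcoef g d"] of_int_of_int ..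
    finally show ?thesis by (simp add: s_def t_def)
  qed
  have "tcoef (f * g) m = (\<Sum>(c, d)\<in>?A. of_int ((-1) ^ (a * b)) *
          (of_int (idx_sgn d c) * (tcoef g d * twist (fcard (fst d)) (tcoef f c))))"
    unfolding tcoef_times by (simp only: *)
  also have "\<dots> = (\<Sum>(d, c)\<in>?A. of_int ((-1) ^ (a * b)) *
          (of_int (idx_sgn d c) * (tcoef g d * twist (fcard (fst d)) (tcoef f c))))"
    by (rule sum.reindex_bij_witness[of _ prod.swap prod.swap])
       (auto simp: idx_add_def sup_commute add.commute)
  also have "\<dots> = tcoef (of_int ((-1) ^ (a * b)) * (g * f)) m"
    unfolding tcoef_of_int_mult unfolding tcoef_times sum_distrib_left by (simp add: split_def)
  finally show "tcoef (f * g) m = tcoef (of_int ((-1) ^ (a * b)) * (g * f)) m" .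
qed

lemma tens_parity_add: "tens_parity e f \<Longrightarrow> tens_parity e g \<Longrightarrow> tens_parity e (f + g)"
  by (simp add: tens_parity_def coh_parity_add)

lemma tens_parity_tmono: "coh_parity (fcard S + e) u \<Longrightarrow> tens_parity e (tmono S R u)"
  by (auto simp: tens_parity_def)

lemma tens_parity_tsum: "(\<And>s. tens_parity e (f s)) \<Longrightarrow> tens_parity e (tsum f)"
  by (auto simp: tens_parity_def tsum_def Sum_any.expand_set intro: coh_parity_sum)


section \<open>Ordered products\<close>

definition oprod :: "(nat \<Rightarrow> 'r::ring_1) \<Rightarrow> nat fset \<Rightarrow> 'r" where
  "oprod a I = prod_list (map a (sorted_list_of_set (fset I)))"

definition mprod :: "(nat \<Rightarrow> 'r::ring_1) \<Rightarrow> (nat \<Rightarrow>\<^sub>0 nat) \<Rightarrow> 'r" where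
  "mprod b m = prod_list (map (\<lambda>i. b i ^ Poly_Mapping.lookup m i) (sorted_list_of_set (Poly_Mapping.keys m)))"

lemma oprod_empty [simp]: "oprod a {||} = 1" by (simp add: oprod_def)

lemma oprod_insert_min:
  assumes "\<And>j. j |\<in>| I \<Longrightarrow> i < j"
  shows "oprod a (finsert i I) = a i * oprod a I"
proof -
  let ?xs = "i # sorted_list_of_set (fset I)"
  have "sorted_list_of_set (set ?xs) = ?xs"
    using assms by (intro sorted_list_of_set.idem_if_sorted_distinct) (auto simp: less_imp_le)
  moreover have "set ?xs = fset (finsert i I)" by simp
  ultimately have "sorted_list_of_set (fset (finsert i I)) = ?xs" by metis
  then show ?thesis unfolding oprod_def by simp
qed

lemma fset_min_induct [case_names empty insert]:
  assumes "P {||}" and "\<And>i I. (\<And>j. j |\<in>| I \<Longrightarrow> i < j) \<Longrightarrow> P I \<Longrightarrow> P (finsert i I)"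
  shows "P (I :: nat fset)"
proof (induction "fcard I" arbitrary: I)
  case 0
  then show ?case using assms(1) by (simp add: fcard_0_eq)
next
  case (Suc n)
  then have ne: "fset I \<noteq> {}" by (auto simp: fcard.rep_eq)
  define i where "i = Min (fset I)"
  have i: "i |\<in>| I" using ne by (simp add: i_def)
  have "P (I |-| {|i|})" using Suc i by (intro Suc(1)) (simp add: fcard.rep_eq)
  moreover have "i < j" if "j |\<in>| I |-| {|i|}" for j
  proof -
    have "i \<le> j" "j \<noteq> i" using that by (auto simp: i_def)
    then show ?thesis by simp
  qed
  ultimately have "P (finsert i (I |-| {|i|}))" by (intro assms(2))
  then show ?case using i by (simp add: finsert_absorb)
qed

lemma oprod_single_mult:
  assumes "\<And>i j. a i * a j = - (a j * a i)" "\<And>i. a i * a i = 0"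
  shows "a i * oprod a J = of_int (shuffle_sgn {|i|} J) * oprod a (finsert i J)"
proof (induction J rule: fset_min_induct)
  case empty
  then show ?case by (simp add: oprod_def)
next
  case (insert j J)
  have jJ: "j |\<notin>| J" using insert(1) by blast
  consider "i < j" | "i = j" | "j < i" by linarith
  then show ?case
  proof cases
    case 1
    then have "inversions {|i|} (finsert j J) = {}" "i |\<notin>| finsert j J"
      using insert(1) by (fastforce simp: inversions_def)+
    then have "shuffle_sgn {|i|} (finsert j J) = 1" by (simp add: shuffle_sgn_def)
    moreover have "oprod a (finsert i (finsert j J)) = a i * oprod a (finsert j J)"
      using 1 insert(1) by (intro oprod_insert_min) (auto intro: less_trans)
    ultimately show ?thesis by simp
  next
    case 2
    then show ?thesis
      using assms(2)[of j] insert(1)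
      by (simp add: oprod_insert_min shuffle_sgn_def flip: mult.assoc)
  next
    case 3
    have sgn: "shuffle_sgn {|i|} (finsert j J) = - shuffle_sgn {|i|} J"
    proof (cases "i |\<in>| J")
      case False
      have "inversions {|i|} (finsert j J) = Set.insert (i, j) (inversions {|i|} J)"
        using 3 by (auto simp: inversions_def)
      moreover have "(i, j) \<notin> inversions {|i|} J" using jJ by (simp add: inversions_def)
      ultimately show ?thesis using False 3 by (simp add: shuffle_sgn_def)
    qed (simp add: shuffle_sgn_def)
    have "a i * oprod a (finsert j J) = - (a j * (a i * oprod a J))"
      using insert(1) assms(1)[of i j] by (simp add: oprod_insert_min flip: mult.assoc)
    also have "\<dots> = of_int (- shuffle_sgn {|i|} J) * (a j * oprod a (finsert i J))"
      by (simp add: insert(2) of_int_shift[of "a j"])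
    also have "a j * oprod a (finsert i J) = oprod a (finsert j (finsert i J))"
      using 3 insert(1) by (intro oprod_insert_min[symmetric]) auto
    finally show ?thesis by (simp only: sgn finsert_commute)
  qed
qed

lemma oprod_mult:
  assumes "\<And>i j. a i * a j = - (a j * a i)" "\<And>i. a i * a i = 0"
  shows "oprod a I * oprod a J = of_int (shuffle_sgn I J) * oprod a (I |\<union>| J)"
proof (induction I rule: fset_min_induct)
  case empty
  then show ?case by simp
next
  case (insert i I)
  have iI: "inversions {|i|} I = {}" "i |\<notin>| I"
    using insert(1) by (fastforce simp: inversions_def)+
  then have 1: "shuffle_sgn {|i|} I = 1" by (simp add: shuffle_sgn_def)
  have "oprod a (finsert i I) * oprod a J = a i * (oprod a I * oprod a J)"
    using insert(1) by (simp add: oprod_insert_min mult.assoc)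
  also have "\<dots> = of_int (shuffle_sgn I J) * (a i * oprod a (I |\<union>| J))"
    by (simp only: insert(2) of_int_shift)
  also have "\<dots> = of_int (shuffle_sgn I J * shuffle_sgn {|i|} (I |\<union>| J)) * oprod a (finsert i (I |\<union>| J))"
    unfolding oprod_single_mult[of a, OF assms] of_int_of_int ..
  also have "shuffle_sgn I J * shuffle_sgn {|i|} (I |\<union>| J) = shuffle_sgn (finsert i I) J"
    using shuffle_sgn_assoc[of "{|i|}" I J] 1 by simp
  finally show ?case by simp
qed

lemma oprod_xgen: "oprod xgen I = hmono I 1"
proof (induction I rule: fset_min_induct)
  case empty
  then show ?case by (rule coh_eqI) simp
next
  case (insert i I)
  have "inversions {|i|} I = {}" "i |\<notin>| I"
    using insert(1) by (fastforce simp: inversions_def)+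
  then have "shuffle_sgn {|i|} I = 1" by (simp add: shuffle_sgn_def)
  then show ?case using insert by (simp add: oprod_insert_min xgen_def hmono_mult)
qed

lemma mprod_upt:
  assumes "Poly_Mapping.keys m \<subseteq> {..<N}"
  shows "mprod b m = prod_list (map (\<lambda>i. b i ^ Poly_Mapping.lookup m i) [0..<N])"
proof -
  have "sorted_list_of_set (Poly_Mapping.keys m) = filter (\<lambda>i. i \<in> Poly_Mapping.keys m) [0..<N]"
    using assms by (intro sorted_distinct_set_unique) (auto intro: sorted_wrt_filter)
  moreover have "prod_list (map (\<lambda>i. b i ^ Poly_Mapping.lookup m i) (filter (\<lambda>i. i \<in> Poly_Mapping.keys m) xs)) =
      prod_list (map (\<lambda>i. b i ^ Poly_Mapping.lookup m i) xs)" for xs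
    by (induction xs) (auto simp: in_keys_iff)
  ultimately show ?thesis by (simp add: mprod_def)
qed

lemma power_commutes_both:
  assumes "x * y = y * (x :: 'r::monoid_mult)"
  shows "x ^ m * y ^ n = y ^ n * x ^ m"
proof -
  have "x * y ^ n = y ^ n * x" by (metis assms power_commuting_commutes)
  then show ?thesis by (metis power_commuting_commutes)
qed

lemma mprod_add:
  assumes comm: "\<And>i j. b i * b j = b j * (b i :: 'r::ring_1)"
  shows "mprod b (m + m') = mprod b m * mprod b m'"
proof -
  obtain N where N: "Poly_Mapping.keys m \<union> Poly_Mapping.keys m' \<subseteq> {..<N}"
    using finite_nat_iff_bounded[of "Poly_Mapping.keys m \<union> Poly_Mapping.keys m'"] by auto
  have c: "b i ^ k * prod_list (map (\<lambda>i. b i ^ f i) xs) = prod_list (map (\<lambda>i. b i ^ f i) xs) * b i ^ k" for i k f xs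
  proof (induction xs)
    case (Cons x xs)
    have "b i ^ k * prod_list (map (\<lambda>i. b i ^ f i) (x # xs)) =
        b x ^ f x * (b i ^ k * prod_list (map (\<lambda>i. b i ^ f i) xs))"
      by (simp add: power_commutes_both[OF comm, of i k x "f x"] flip: mult.assoc)
    then show ?case by (simp add: Cons mult.assoc)
  qed simp
  have "prod_list (map (\<lambda>i. b i ^ (f i + g i)) xs) =
      prod_list (map (\<lambda>i. b i ^ f i) xs) * prod_list (map (\<lambda>i. b i ^ g i) xs)" for f g xs
  proof (induction xs)
    case (Cons x xs)
    have "b x ^ g x * prod_list (map (\<lambda>i. b i ^ f i) xs) * r =
        prod_list (map (\<lambda>i. b i ^ f i) xs) * (b x ^ g x * r)" for r
      by (simp only: c mult.assoc)
    with Cons show ?case by (simp add: power_add mult.assoc)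
  qed simp
  moreover have "Poly_Mapping.keys (m + m') \<subseteq> {..<N}"
    using N keys_add[of m m'] by blast
  ultimately show ?thesis using N by (simp add: mprod_upt[of _ N] lookup_add)
qed

lemma mprod_0 [simp]: "mprod b 0 = 1" by (simp add: mprod_def)

lemma mprod_single [simp]: "mprod b (Poly_Mapping.single i k) = b i ^ k"
  by (cases "k = 0") (simp_all add: mprod_def)


section \<open>The coaction and the operations \<open>St\<^sup>S\<^sup>,\<^sup>R\<close>\<close>

text \<open>The exponent of \<open>\<xi>\<^sub>s\<close>, with \<open>\<xi>\<^sub>0 = 1\<close>.\<close>
definition xi_exp :: "nat \<Rightarrow> (nat \<Rightarrow>\<^sub>0 nat)" where
  "xi_exp s = (if s = 0 then 0 else Poly_Mapping.single (s - 1) 1)"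

definition lam_x :: "nat \<Rightarrow> 'p::prime_card mod_ring tens" where
  "lam_x i = tmono {||} 0 (xgen i) + tsum (\<lambda>s. tmono {|s|} 0 (ygen i ^ (CARD('p) ^ s)))"

definition lam_y :: "nat \<Rightarrow> 'p::prime_card mod_ring tens" where
  "lam_y i = tsum (\<lambda>s. tmono {||} (xi_exp s) (ygen i ^ (CARD('p) ^ s)))"

definition lam_poly :: "'p::prime_card mod_ring ypoly \<Rightarrow> 'p mod_ring tens" where
  "lam_poly f = (\<Sum>m\<in>Poly_Mapping.keys f.
     tmono {||} 0 (hpoly (Poly_Mapping.single 0 (Poly_Mapping.lookup f m))) * mprod lam_y m)"

text \<open>
  The coaction \<open>\<lambda>\<close>. The lemmas \<open>lam_one\<close>, \<open>lam_add\<close>, \<open>lam_mult\<close>, \<open>lam_xgen\<close> and \<open>lam_ygen\<close> below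
  show that for odd \<open>p\<close> it is the ring homomorphism with the prescribed values on the generators.
\<close>
definition lam :: "'p::prime_card mod_ring coh \<Rightarrow> 'p mod_ring tens" where
  "lam u = (\<Sum>I | ecoef u I \<noteq> 0. oprod lam_x I * lam_poly (ecoef u I))"

definition minus_one_powi :: "int \<Rightarrow> 'r::ring_1" where
  "minus_one_powi e = (if even e then 1 else - 1)"

text \<open>
  The relation \<open>\<lambda>(u) = \<Sum> (-1) ^ (t (dim u - t)) St\<^sup>S\<^sup>,\<^sup>R u \<otimes> \<tau>\<^sub>S \<xi>\<^sup>R\<close>, for \<open>u\<close> homogeneous and \<open>t\<close> the
  length of \<open>S\<close>, is solved for \<open>St\<^sup>S\<^sup>,\<^sup>R u\<close> and extended linearly: the summand \<open>x I * f\<close> of \<open>u\<close> lies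
  in degrees congruent to \<open>|I|\<close> mod 2. See \<open>lam_eq_St\<close> below.
\<close>
definition St :: "nat list \<Rightarrow> nat list \<Rightarrow> 'p::prime_card mod_ring coh \<Rightarrow> 'p mod_ring coh" where
  "St S R u = (\<Sum>I | ecoef u I \<noteq> 0.
     minus_one_powi (int (length S) * (int (fcard I) - int (length S))) *
     tcoef (lam (hmono I (ecoef u I))) (fset_of_list S, Poly_Mapping.nth R))"

subsection \<open>The coaction is a ring homomorphism\<close>

lemma tens_parity_lam_x: "tens_parity 1 (lam_x i)"
  unfolding lam_x_def ygen_def hpoly_power[symmetric]
  by (intro tens_parity_add tens_parity_tsum tens_parity_tmono coh_parity_hpoly coh_parity_xgen)
     (simp_all add: fcard.rep_eq)

lemma tens_parity_lam_y: "tens_parity 0 (lam_y i)"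
  unfolding lam_y_def ygen_def hpoly_power[symmetric]
  by (intro tens_parity_tsum tens_parity_tmono coh_parity_hpoly) (simp add: fcard.rep_eq)

lemma lam_x_anticommute: "lam_x i * lam_x j = - (lam_x j * lam_x i)"
  using tens_commute[OF tens_parity_lam_x tens_parity_lam_x, of i j] by simp

lemma lam_y_commute: "lam_y i * lam_y j = lam_y j * lam_y i"
  using tens_commute[OF tens_parity_lam_y tens_parity_lam_y, of i j] by simp

lemma lam_y_lam_x_commute: "lam_y i * lam_x j = lam_x j * lam_y i"
  using tens_commute[OF tens_parity_lam_y tens_parity_lam_x, of i j] by simp

lemma mod_ring_double_zero:
  assumes "odd CARD('p::prime_card)" "c = - (c :: 'p mod_ring)"
  shows "c = 0"
proof -
  have "of_nat 2 * c = c + c" unfolding of_nat_numeral mult_2 ..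
  also have "\<dots> = c + - c" using assms(2) by (rule arg_cong)
  also have "\<dots> = 0" by (rule right_minus)
  finally have "of_nat 2 * c = 0" .
  moreover have "of_nat 2 \<noteq> (0 :: 'p mod_ring)"
  proof
    assume "of_nat 2 = (0 :: 'p mod_ring)"
    then have "CHAR('p mod_ring) dvd 2" by (simp only: of_nat_eq_0_iff_char_dvd)
    then have "CARD('p) dvd 2" unfolding semiring_char_mod_ring .
    then have "CARD('p) = 1 \<or> CARD('p) = 2"
      using prime_nat_iff two_is_prime_nat by blast
    then show False using assms(1) prime_card[where 'a = 'p] by auto
  qed
  ultimately show ?thesis by (metis mult_eq_0_iff)
qed

lemma lam_x_square:
  assumes "odd CARD('p::prime_card)"
  shows "lam_x i * lam_x i = (0 :: 'p mod_ring tens)"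
proof (rule tens_eqI, rule coh_eqI, rule poly_mapping_eqI)
  fix m I k
  let ?c = "\<lambda>f :: 'p mod_ring tens. Poly_Mapping.lookup (ecoef (tcoef f m) I) k"
  have "?c (lam_x i * lam_x i) = ?c (- (lam_x i * lam_x i))"
    using lam_x_anticommute[of i i] by metis
  then have "?c (lam_x i * lam_x i) = - ?c (lam_x i * lam_x i)"
    by (simp only: tcoef_uminus ecoef_uminus lookup_uminus)
  then have "?c (lam_x i * lam_x i) = 0" by (rule mod_ring_double_zero[OF assms])
  then show "?c (lam_x i * lam_x i) = ?c 0" by simp
qed

abbreviation "tconst c \<equiv> tmono {||} 0 (hpoly (Poly_Mapping.single 0 c))"

lemma tconst_add: "tconst (c + d) = tconst c + tconst d"
  by (rule tens_eqI) (simp add: single_add hpoly_add)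

lemma tmono_zero [simp]: "tmono S R 0 = 0"
  by (rule tens_eqI) simp

lemma tconst_mult: "tconst (c * d) = tconst c * tconst d"
  by (simp add: tmono_mult fcard.rep_eq mult_single flip: hpoly_mult)

lemma tmono_one [simp]: "tmono {||} 0 1 = 1"
  by (rule tens_eqI) simp

lemma tconst_parity: "tens_parity 0 (tconst c)"
  by (intro tens_parity_tmono coh_parity_hpoly) (simp add: fcard.rep_eq)

lemma tconst_lam_x: "tconst c * lam_x i = lam_x i * tconst c"
  using tens_commute[OF tconst_parity tens_parity_lam_x, of c i] by simp

lemma tconst_lam_y: "tconst c * lam_y i = lam_y i * tconst c"
  using tens_commute[OF tconst_parity tens_parity_lam_y, of c i] by simp

lemma commutes_mprod:
  assumes "\<And>i. b i * z = z * (b i :: 'r::ring_1)"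
  shows "mprod b m * z = z * mprod b m"
proof -
  have "b i ^ k * z = z * b i ^ k" for i k
    using power_commutes_both[OF assms, of i k 1] by simp
  then have "prod_list (map (\<lambda>i. b i ^ f i) xs) * z = z * prod_list (map (\<lambda>i. b i ^ f i) xs)" for f xs
    by (induction xs) (simp_all, metis mult.assoc)
  then show ?thesis by (simp add: mprod_def)
qed

lemma commutes_oprod:
  assumes "\<And>i. a i * z = z * (a i :: 'r::ring_1)"
  shows "oprod a I * z = z * oprod a I"
proof -
  have "prod_list (map a xs) * z = z * prod_list (map a xs)" for xs
    using assms by (induction xs) (simp_all, metis mult.assoc)
  then show ?thesis by (simp add: oprod_def)
qed

lemma lam_poly_superset:
  assumes "finite A" "Poly_Mapping.keys f \<subseteq> A"
  shows "lam_poly f = (\<Sum>m\<in>A. tconst (Poly_Mapping.lookup f m) * mprod lam_y m)"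
  unfolding lam_poly_def using assms
  by (intro sum.mono_neutral_left) (auto simp: in_keys_iff)

lemma lam_poly_add: "lam_poly (f + g) = lam_poly f + lam_poly g"
proof -
  let ?A = "Poly_Mapping.keys f \<union> Poly_Mapping.keys g"
  have "lam_poly h = (\<Sum>m\<in>?A. tconst (Poly_Mapping.lookup h m) * mprod lam_y m)"
    if "Poly_Mapping.keys h \<subseteq> ?A" for h
    using that by (intro lam_poly_superset) auto
  note * = this
  show ?thesis
    using keys_add[of f g]
    by (simp add: * lookup_add tconst_add distrib_right sum.distrib)
qed

lemma lam_poly_zero [simp]: "lam_poly 0 = 0" by (simp add: lam_poly_def)

lemma lam_poly_sum: "lam_poly (sum f A) = (\<Sum>a\<in>A. lam_poly (f a))"
  by (induction A rule: infinite_finite_induct) (simp_all add: lam_poly_add)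

lemma lam_poly_single: "lam_poly (Poly_Mapping.single m c) = tconst c * mprod lam_y m"
  by (cases "c = 0") (simp_all add: lam_poly_def)

lemma lam_poly_one [simp]: "lam_poly 1 = 1"
  using lam_poly_single[of 0 1] by simp

lemma poly_expand: "f = (\<Sum>m\<in>Poly_Mapping.keys f. Poly_Mapping.single m (Poly_Mapping.lookup f m))"
  by (rule poly_mapping_eqI) (auto simp: lookup_sum lookup_single when_def in_keys_iff)

lemma lam_poly_mult: "lam_poly (f * g) = lam_poly f * lam_poly g"
proof -
  have single: "lam_poly (Poly_Mapping.single m c * Poly_Mapping.single m' c') =
      lam_poly (Poly_Mapping.single m c) * lam_poly (Poly_Mapping.single m' c')" for m c m' c'
  proof -
    have "mprod lam_y m * tconst c' = tconst c' * mprod lam_y m"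
      by (rule commutes_mprod) (simp add: tconst_lam_y)
    then have "mprod lam_y m * (tconst c' * mprod lam_y m') = tconst c' * (mprod lam_y m * mprod lam_y m')"
      by (simp flip: mult.assoc)
    then show ?thesis
      by (simp add: mult_single lam_poly_single tconst_mult mult.assoc mprod_add[OF lam_y_commute])
  qed
  let ?e = "\<lambda>f. \<Sum>m\<in>Poly_Mapping.keys f. Poly_Mapping.single m (Poly_Mapping.lookup f m)"
  have "lam_poly (?e f * ?e g) = lam_poly (?e f) * lam_poly (?e g)"
    by (simp add: sum_product lam_poly_sum single)
  then show ?thesis by (simp flip: poly_expand)
qed

lemma lam_poly_of_int: "lam_poly (of_int k) = of_int k"
proof -
  have nat: "lam_poly (of_nat n) = of_nat n" for n
    by (induction n) (simp_all add: lam_poly_add)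
  obtain a b where k: "k = int a - int b" by (rule int_diff_cases)
  have "lam_poly (of_int k) + lam_poly (of_nat b) = lam_poly (of_nat a)"
    by (simp add: k flip: lam_poly_add)
  then show ?thesis by (simp add: nat k eq_diff_eq)
qed

lemma lam_poly_oprod:
  fixes f :: "'p::prime_card mod_ring ypoly"
  shows "lam_poly f * oprod lam_x I = oprod lam_x I * lam_poly f"
proof -
  have "tconst c * mprod lam_y m * oprod lam_x I = oprod lam_x I * (tconst c * mprod lam_y m)"
    for c :: "'p mod_ring" and m
  proof -
    have 1: "mprod lam_y m * oprod lam_x I = oprod lam_x I * mprod lam_y m"
      by (rule commutes_mprod, rule commutes_oprod[symmetric]) (simp add: lam_y_lam_x_commute)
    have 2: "oprod lam_x I * tconst c = tconst c * oprod lam_x I"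
      by (rule commutes_oprod) (simp add: tconst_lam_x)
    show ?thesis by (simp add: 1 2 mult.assoc) (simp add: 2 flip: mult.assoc)
  qed
  then show ?thesis by (simp add: lam_poly_def sum_distrib_left sum_distrib_right)
qed

lemma lam_superset:
  assumes "finite A" "{I. ecoef u I \<noteq> 0} \<subseteq> A"
  shows "lam u = (\<Sum>I\<in>A. oprod lam_x I * lam_poly (ecoef u I))"
  unfolding lam_def using assms by (intro sum.mono_neutral_left) auto

lemma lam_add: "lam (u + v) = lam u + lam v"
proof -
  let ?A = "{I. ecoef u I \<noteq> 0} \<union> {I. ecoef v I \<noteq> 0}"
  have *: "lam w = (\<Sum>I\<in>?A. oprod lam_x I * lam_poly (ecoef w I))"
    if "{I. ecoef w I \<noteq> 0} \<subseteq> ?A" for w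
    using that by (intro lam_superset) auto
  have "{I. ecoef (u + v) I \<noteq> 0} \<subseteq> ?A" by auto
  then show ?thesis
    by (simp only: * Un_upper1 Un_upper2 ecoef_plus lam_poly_add distrib_left sum.distrib)
qed

lemma lam_zero [simp]: "lam 0 = 0" by (simp add: lam_def)

lemma lam_sum: "lam (sum f A) = (\<Sum>a\<in>A. lam (f a))"
  by (induction A rule: infinite_finite_induct) (simp_all add: lam_add)

lemma lam_hmono: "lam (hmono I f) = oprod lam_x I * lam_poly f"
proof -
  have "lam (hmono I f) = (\<Sum>J\<in>{I}. oprod lam_x J * lam_poly (ecoef (hmono I f) J))"
    by (rule lam_superset) auto
  then show ?thesis by simp
qed

lemma lam_hpoly: "lam (hpoly f) = lam_poly f"
  by (simp add: hpoly_def lam_hmono)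

lemma lam_one: "lam 1 = 1"
  using lam_hpoly[of 1] by simp

lemma lam_mult:
  assumes "odd CARD('p::prime_card)"
  shows "lam (u * v) = lam u * lam (v :: 'p mod_ring coh)"
proof -
  have "lam (hmono I f * hmono J g) = lam (hmono I f) * lam (hmono J (g :: 'p mod_ring ypoly))" for I J f g
  proof -
    have "lam (hmono I f) * lam (hmono J g) =
        oprod lam_x I * oprod lam_x J * (lam_poly f * lam_poly g)"
      unfolding lam_hmono by (metis lam_poly_oprod mult.assoc)
    also have "\<dots> = of_int (shuffle_sgn I J) * oprod lam_x (I |\<union>| J) * lam_poly (f * g)"
      by (simp only: oprod_mult[of lam_x, OF lam_x_anticommute lam_x_square[OF assms]] lam_poly_mult)
    also have "\<dots> = oprod lam_x (I |\<union>| J) * lam_poly (of_int (shuffle_sgn I J) * (f * g))"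
      by (simp only: lam_poly_mult[of "of_int _"] lam_poly_of_int mult.assoc of_int_shift)
    finally show ?thesis by (simp add: hmono_mult lam_hmono mult.assoc)
  qed
  then have "lam ((\<Sum>I | ecoef u I \<noteq> 0. hmono I (ecoef u I)) * (\<Sum>I | ecoef v I \<noteq> 0. hmono I (ecoef v I))) =
      lam (\<Sum>I | ecoef u I \<noteq> 0. hmono I (ecoef u I)) * lam (\<Sum>I | ecoef v I \<noteq> 0. hmono I (ecoef v I))"
    by (simp add: sum_product lam_sum)
  then show ?thesis by (simp flip: coh_expand)
qed

lemma lam_xgen: "lam (xgen i) = lam_x i"
  by (simp add: xgen_def lam_hmono oprod_def)

lemma lam_ygen: "lam (ygen i) = lam_y i"
  by (simp add: ygen_def lam_hpoly yvar_def lam_poly_single)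

definition homogeneous :: "nat \<Rightarrow> 'a::comm_ring_1 coh \<Rightarrow> bool" where
  "homogeneous d u \<longleftrightarrow> (\<forall>I m. Poly_Mapping.lookup (ecoef u I) m \<noteq> 0 \<longrightarrow>
     fcard I + 2 * (\<Sum>i\<in>Poly_Mapping.keys m. Poly_Mapping.lookup m i) = d)"

lemma lam_eq_St:
  assumes "homogeneous d u"
  shows "tcoef (lam u) (fset_of_list S, Poly_Mapping.nth R) =
         minus_one_powi (int (length S) * (int d - int (length S))) * St S R u"
proof -
  let ?t = "int (length S)"
  have sgn: "minus_one_powi (?t * (int d - ?t)) * (minus_one_powi (?t * (int (fcard I) - ?t)) * z) = z"
    if "ecoef u I \<noteq> 0" for I and z :: "'a mod_ring coh"
  proof -
    obtain m where "Poly_Mapping.lookup (ecoef u I) m \<noteq> 0"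
      using \<open>ecoef u I \<noteq> 0\<close> by (metis lookup_zero poly_mapping_eqI)
    then have "fcard I + 2 * (\<Sum>i\<in>Poly_Mapping.keys m. Poly_Mapping.lookup m i) = d"
      using assms by (simp add: homogeneous_def)
    then have "even (fcard I) = even d" by auto
    then show ?thesis by (auto simp: minus_one_powi_def)
  qed
  have "tcoef (lam u) x = (\<Sum>I | ecoef u I \<noteq> 0. tcoef (lam (hmono I (ecoef u I))) x)" for x
    unfolding lam_hmono by (simp add: lam_def)
  then show ?thesis
    unfolding St_def sum_distrib_left by (simp add: sgn)
qed


section \<open>Dickson and Mui invariants\<close>

text \<open>
  \<open>ydet n J a\<close> is the determinant of \<open>y\<^sub>i ^ (p ^ e)\<close>, the rows indexed by the elements \<open>i\<close> of the
  list \<open>J\<close> and the columns by the elements \<open>e\<close> of the list \<open>a\<close>.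
\<close>
definition ydet :: "nat list \<Rightarrow> nat list \<Rightarrow> 'p::prime_card mod_ring ypoly" where
  "ydet J a = det (mat (length J) (length a) (\<lambda>(u, v). yvar (J ! u) ^ (CARD('p) ^ (a ! v))))"

definition shuffle_perm :: "nat \<Rightarrow> nat set \<Rightarrow> nat \<Rightarrow> nat" where
  "shuffle_perm n I j =
     (if j \<in> {1..n} then (sorted_list_of_set I @ sorted_list_of_set ({1..n} - I)) ! (j - 1) else j)"

text \<open>\<open>mui_bracket n k a\<close> is \<open>[k; a\<^sub>k\<^sub>+\<^sub>1, \<dots>, a\<^sub>n]\<close> for a list \<open>a\<close> of length \<open>n - k\<close>.\<close>
definition mui_bracket :: "nat \<Rightarrow> nat \<Rightarrow> nat list \<Rightarrow> 'p::prime_card mod_ring coh" where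
  "mui_bracket n k a = (\<Sum>I | I \<subseteq> {1..n} \<and> card I = k.
     of_int (sign (shuffle_perm n I)) *
     prod_list (map xgen (sorted_list_of_set I)) *
     hpoly (ydet (sorted_list_of_set ({1..n} - I)) a))"

definition mui :: "nat \<Rightarrow> nat list \<Rightarrow> 'p::prime_card mod_ring coh" where
  "mui n us = mui_bracket n (length us) (filter (\<lambda>a. a \<notin> set us) [0..<n])"

definition dickson_L :: "nat \<Rightarrow> nat \<Rightarrow> 'p::prime_card mod_ring ypoly" where
  "dickson_L n s = ydet [1..<n + 1] (filter (\<lambda>a. a \<noteq> s) [0..<n + 1])"

text \<open>The polynomials form an integral domain, in which \<open>L\<^sub>n\<close> is nonzero, so the quotient is unique.\<close>
definition dickson_Q :: "nat \<Rightarrow> nat \<Rightarrow> 'p::prime_card mod_ring ypoly" where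
  "dickson_Q n s = (THE q. q * dickson_L n n = dickson_L n s)"

text \<open>The sequence \<open>\<Delta>\<^sub>i\<close> of length \<open>n\<close>; list positions start at 0, and \<open>Delta n 0\<close> is the zero sequence.\<close>
definition Delta :: "nat \<Rightarrow> nat \<Rightarrow> nat list" where
  "Delta n i = map (\<lambda>j. if j = i then 1 else 0) [1..<n + 1]"

definition omit_nth :: "nat \<Rightarrow> 'b list \<Rightarrow> 'b list" where
  "omit_nth t xs = take t xs @ drop (Suc t) xs"

end

theory Submission
  imports Defs
begin

text \<open>
  The class \<open>M\<^sub>n\<^sub>,\<^sub>1\<^sub>,\<^sub>\<dots>\<^sub>,\<^sub>n\<^sub>-\<^sub>1\<close> is \<open>[n - 1; 0] = \<Sum>\<^sub>j \<plusminus>x\<^sub>1 \<dots> x\<^sub>n y\<^sub>j\<close>, with \<open>x\<^sub>j\<close> omitted. In its coaction each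
  \<open>x\<^sub>i\<close> contributes either itself or \<open>\<Sum>\<^sub>s y\<^sub>i ^ (p ^ s) \<otimes> \<tau>\<^sub>s\<close>, and \<open>y\<^sub>j\<close> contributes
  \<open>\<Sum>\<^sub>s y\<^sub>j ^ (p ^ s) \<otimes> \<xi>\<^sub>s\<close>. As the \<open>\<tau>\<^sub>s\<close> anticommute, the \<open>\<tau>\<^sub>T\<close>-coefficient of a product of the former
  sums is a determinant, and Laplace expansion along the last column identifies the coefficient of
  \<open>\<tau>\<^sub>S\<^sub>' \<xi>\<^sub>r\<close> with \<open>[k; S', r]\<close>. This vanishes for \<open>r \<in> S'\<close>, is a Mui invariant up to the order of its
  columns for the other \<open>r < n\<close>, and for \<open>r = n\<close> is reduced to these by the relation
  \<open>y\<^sub>i ^ (p ^ n) = \<Sum>\<^sub>r\<^sub><\<^sub>n \<plusminus>Q\<^sub>n\<^sub>,\<^sub>r y\<^sub>i ^ (p ^ r)\<close>.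
\<close>

section \<open>Determinants of powers of the \<open>y\<^sub>i\<close>\<close>

lemma length_omit_nth [simp]: "t < length xs \<Longrightarrow> length (omit_nth t xs) = length xs - 1"
  by (auto simp: omit_nth_def)

lemma nth_omit_nth:
  "t < length xs \<Longrightarrow> u < length xs - 1 \<Longrightarrow> omit_nth t xs ! u = xs ! (if u < t then u else Suc u)"
  by (auto simp: omit_nth_def nth_append)

lemma omit_nth_append_Cons: "omit_nth (length xs) (xs @ a # ys) = xs @ ys"
  by (simp add: omit_nth_def)

lemma omit_nth_Cons: "omit_nth 0 (x # xs) = xs" "omit_nth (Suc i) (x # xs) = x # omit_nth i xs"
  by (simp_all add: omit_nth_def)

abbreviation ymat :: "nat list \<Rightarrow> nat list \<Rightarrow> 'p::prime_card mod_ring ypoly mat" where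
  "ymat J a \<equiv> mat (length J) (length a) (\<lambda>(u, v). yvar (J ! u) ^ (CARD('p) ^ (a ! v)))"

lemma mat_delete_ymat:
  assumes "i < length J" "j < length a"
  shows "mat_delete (ymat J a :: 'p::prime_card mod_ring ypoly mat) i j = ymat (omit_nth i J) (omit_nth j a)"
  using assms by (intro eq_matI) (auto simp: mat_delete_def nth_omit_nth)

lemma ydet_Nil [simp]: "ydet [] [] = 1"
  by (simp add: ydet_def)

text \<open>The column of \<open>e\<close> is isolated because the minors then do not involve
  \<open>e\<close>; moving or replacing one column is read off from this form.\<close>

lemma ydet_expand_column:
  assumes "length J = length xs + length ys + 1"
  shows "(ydet J (xs @ e # ys) :: 'p::prime_card mod_ring ypoly) =
    (\<Sum>i<length J. (-1) ^ (i + length xs) * yvar (J ! i) ^ (CARD('p) ^ e) * ydet (omit_nth i J) (xs @ ys))"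
proof -
  let ?a = "xs @ e # ys"
  let ?A = "ymat J ?a :: 'p mod_ring ypoly mat"
  have l: "length ?a = length J" using assms by simp
  have "ydet J ?a = (\<Sum>i<length J. ?A $$ (i, length xs) * cofactor ?A i (length xs))"
    unfolding ydet_def using assms l by (intro laplace_expansion_column) auto
  also have "\<dots> = (\<Sum>i<length J. (-1) ^ (i + length xs) * yvar (J ! i) ^ (CARD('p) ^ e) * ydet (omit_nth i J) (xs @ ys))"
  proof (rule sum.cong[OF refl])
    fix i assume "i \<in> {..<length J}"
    then have i: "i < length J" by simp
    have "mat_delete ?A i (length xs) = ymat (omit_nth i J) (xs @ ys)"
      using i mat_delete_ymat[of i J "length xs" ?a] by (simp add: omit_nth_append_Cons)
    then show "?A $$ (i, length xs) * cofactor ?A i (length xs) = 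
        (-1) ^ (i + length xs) * yvar (J ! i) ^ (CARD('p) ^ e) * ydet (omit_nth i J) (xs @ ys)"
      using i by (simp add: cofactor_def ydet_def mult_ac)
  qed
  finally show ?thesis .
qed

lemma ydet_expand_row:
  assumes "length a = Suc (length J)"
  shows "(ydet (i # J) a :: 'p::prime_card mod_ring ypoly) =
    (\<Sum>t<length a. (-1) ^ t * yvar i ^ (CARD('p) ^ (a ! t)) * ydet J (omit_nth t a))"
proof -
  let ?A = "ymat (i # J) a :: 'p mod_ring ypoly mat"
  have "ydet (i # J) a = (\<Sum>t<length a. ?A $$ (0, t) * cofactor ?A 0 t)"
    unfolding ydet_def using assms by (intro laplace_expansion_row) auto
  also have "\<dots> = (\<Sum>t<length a. (-1) ^ t * yvar i ^ (CARD('p) ^ (a ! t)) * ydet J (omit_nth t a))"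
  proof (rule sum.cong[OF refl])
    fix t assume "t \<in> {..<length a}"
    then have t: "t < length a" by simp
    have "mat_delete ?A 0 t = ymat J (omit_nth t a)"
      using t mat_delete_ymat[of 0 "i # J" t a] by (simp add: omit_nth_Cons)
    then show "?A $$ (0, t) * cofactor ?A 0 t = 
        (-1) ^ t * yvar i ^ (CARD('p) ^ (a ! t)) * ydet J (omit_nth t a)"
      using t by (simp add: cofactor_def ydet_def mult_ac)
  qed
  finally show ?thesis .
qed

text \<open>Expanding both sides down the column of \<open>e\<close> gives the same minors; only the
  position of the column in the Laplace sign differs, by \<open>length ys\<close>.\<close>

lemma ydet_move_column:
  assumes "length J = length xs + length ys + 1"
  shows "ydet J (xs @ ys @ [e]) = (-1) ^ length ys * (ydet J (xs @ e # ys) :: 'p::prime_card mod_ring ypoly)"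
proof -
  have "ydet J ((xs @ ys) @ e # []) = (\<Sum>i<length J. (-1) ^ (i + length (xs @ ys)) *
      yvar (J ! i) ^ (CARD('p) ^ e) * (ydet (omit_nth i J) ((xs @ ys) @ []) :: 'p mod_ring ypoly))"
    using assms by (intro ydet_expand_column) simp
  then show ?thesis
    by (simp only: ydet_expand_column[OF assms] sum_distrib_left power_add length_append append_assoc
        append_Nil2 mult_ac)
qed

lemma ydet_repeated_column:
  assumes "\<not> distinct a" "length J = length a"
  shows "ydet J a = 0"
proof -
  obtain u v where "u < length a" "v < length a" "u \<noteq> v" "a ! u = a ! v"
    using assms(1) by (auto simp: distinct_conv_nth)
  then show ?thesis unfolding ydet_def using assms(2)
    by (intro det_identical_columns[of _ "length a" u v]) (auto simp: col_def intro!: eq_vecI)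
qed

text \<open>The minors along the last column do not depend on its exponent, so a relation between
  the powers whose coefficients \<open>c r\<close> are common to all rows passes to the
  determinants.\<close>

lemma ydet_last_column_linear:
  assumes "length J = Suc (length xs)" "finite A"
    and "\<And>i. i \<in> set J \<Longrightarrow> yvar i ^ (CARD('p) ^ e) = (\<Sum>r\<in>A. c r * yvar i ^ (CARD('p) ^ r))"
  shows "(ydet J (xs @ [e]) :: 'p::prime_card mod_ring ypoly) = (\<Sum>r\<in>A. c r * ydet J (xs @ [r]))"
proof -
  let ?D = "\<lambda>i. ydet (omit_nth i J) xs :: 'p mod_ring ypoly"
  have col: "ydet J (xs @ [e]) = (\<Sum>i<length J. (-1) ^ (i + length xs) * yvar (J ! i) ^ (CARD('p) ^ e) * ?D i)" for e
    using ydet_expand_column[where J = J and xs = xs and ys = "[]" and e = e and 'p = 'p] assms(1) by simp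
  have "ydet J (xs @ [e]) = (\<Sum>i<length J. \<Sum>r\<in>A. c r * ((-1) ^ (i + length xs) * yvar (J ! i) ^ (CARD('p) ^ r) * ?D i))"
    unfolding col using assms(3)
    by (intro sum.cong refl) (simp add: sum_distrib_left sum_distrib_right mult_ac)
  also have "\<dots> = (\<Sum>r\<in>A. c r * ydet J (xs @ [r]))"
    unfolding col sum_distrib_left by (rule sum.swap)
  finally show ?thesis .
qed

section \<open>Dickson invariants\<close>

text \<open>Makes the p-th power additive on polynomials; the value is read off from the constant
  polynomials.\<close>

lemma semiring_char_ypoly: "CHAR('p::prime_card mod_ring ypoly) = CARD('p)"
proof (rule CHAR_eqI)
  have "of_nat CARD('p) = (0 :: 'p mod_ring)"
    using of_nat_CHAR[where 'a = "'p mod_ring"] by simp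
  then show "of_nat CARD('p) = (0 :: 'p mod_ring ypoly)"
    by (metis single_of_nat single_zero)
next
  fix x assume "of_nat x = (0 :: 'p mod_ring ypoly)"
  then have "of_nat x = (0 :: 'p mod_ring)"
    by (metis lookup_single_eq lookup_zero single_of_nat)
  then show "CARD('p) dvd x" by (simp add: of_nat_eq_0_iff_char_dvd)
qed

text \<open>
  With \<open>f\<^sub>n(z) = \<Sum>\<^sub>s c\<^sub>s z ^ (p ^ s)\<close>, the polynomial
  \<open>f\<^sub>n\<^sub>+\<^sub>1(z) = f\<^sub>n(z) ^ p - f\<^sub>n(y\<^sub>n\<^sub>+\<^sub>1) ^ (p - 1) * f\<^sub>n(z)\<close> is again additive and monic, vanishes where
  \<open>f\<^sub>n\<close> does, and vanishes at \<open>y\<^sub>n\<^sub>+\<^sub>1\<close>.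
\<close>
lemma ex_additive_polynomial:
  "\<exists>c :: nat \<Rightarrow> 'p::prime_card mod_ring ypoly.
     c n = 1 \<and> (\<forall>i\<in>{1..n}. (\<Sum>s\<le>n. c s * yvar i ^ (CARD('p) ^ s)) = 0)"
proof (induction n)
  case 0
  then show ?case by (intro exI[of _ "\<lambda>_. 1"]) simp
next
  case (Suc n)
  let ?p = "CARD('p)"
  have p: "prime ?p" by (rule prime_card)
  then obtain p' where p': "?p = Suc p'" by (metis not0_implies_Suc not_prime_0)
  obtain c :: "nat \<Rightarrow> 'p mod_ring ypoly" where c: "c n = 1"
      "\<And>i. i \<in> {1..n} \<Longrightarrow> (\<Sum>s\<le>n. c s * yvar i ^ (?p ^ s)) = 0"
    using Suc by blast
  define f where "f z = (\<Sum>s\<le>n. c s * z ^ (?p ^ s))" for z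
  define d where "d = f (yvar (Suc n)) ^ p'"
  \<comment> \<open>The p-th power of \<open>f\<close> shifts the index by one, while the subtracted
    multiple of \<open>f\<close> stops at \<open>n\<close>; hence the new top coefficient is the
    p-th power of \<open>c n = 1\<close>.\<close>
  define c' where "c' s = (if s = 0 then 0 else c (s - 1) ^ ?p) - (if s \<le> n then d * c s else 0)" for s
  have f: "(\<Sum>s\<le>Suc n. c' s * z ^ (?p ^ s)) = f z ^ ?p - d * f z" for z
  proof -
    have "f z ^ ?p = (\<Sum>s\<le>n. (c s * z ^ (?p ^ s)) ^ ?p)"
      unfolding f_def by (rule freshmans_dream_sum) (simp_all add: semiring_char_ypoly p)
    also have "\<dots> = (\<Sum>s\<le>n. c s ^ ?p * z ^ (?p ^ Suc s))"
      by (intro sum.cong refl) (simp add: power_mult_distrib mult.commute flip: power_mult)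
    also have "\<dots> = (\<Sum>s\<le>Suc n. (if s = 0 then 0 else c (s - 1) ^ ?p) * z ^ (?p ^ s))"
      by (subst sum.atMost_Suc_shift) simp
    finally have 1: "f z ^ ?p = (\<Sum>s\<le>Suc n. (if s = 0 then 0 else c (s - 1) ^ ?p) * z ^ (?p ^ s))" .
    have 2: "d * f z = (\<Sum>s\<le>Suc n. (if s \<le> n then d * c s else 0) * z ^ (?p ^ s))"
      by (simp add: f_def sum_distrib_left mult.assoc)
    show ?thesis unfolding 1 2 c'_def left_diff_distrib sum_subtractf ..
  qed
  have "f (yvar i) ^ ?p - d * f (yvar i) = 0" if "i \<in> {1..Suc n}" for i
  proof (cases "i = Suc n")
    case True
    then show ?thesis by (simp add: d_def p')
  next
    case False
    then have "f (yvar i) = 0" using that c(2) by (simp add: f_def)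
    then show ?thesis by (simp add: p')
  qed
  then have "\<forall>i\<in>{1..Suc n}. (\<Sum>s\<le>Suc n. c' s * yvar i ^ (?p ^ s)) = 0" unfolding f by blast
  moreover have "c' (Suc n) = 1" by (simp add: c'_def c(1))
  ultimately show ?case by blast
qed

section \<open>Nonvanishing of L_n, and Dickson invariants as coefficients\<close>

lemma yvar_power: "yvar i ^ k = Poly_Mapping.single (Poly_Mapping.single i k) 1"
proof (induction k)
  case (Suc k)
  have "Poly_Mapping.single i 1 + Poly_Mapping.single i k = Poly_Mapping.single i (Suc k)"
    by (simp flip: single_add)
  with Suc show ?case by (simp add: yvar_def mult_single)
qed simp

lemma prod_single_one:
  "(\<Prod>u\<in>A. Poly_Mapping.single (g u) 1) = Poly_Mapping.single (\<Sum>u\<in>A. g u) (1 :: 'a::comm_semiring_1)"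
  by (induction A rule: infinite_finite_induct) (simp_all add: mult_single)

lemma upt_split_at: "s < n \<Longrightarrow> [0..<n] = [0..<s] @ s # [s + 1..<n]"
  using upt_add_eq_append[of 0 s "n - s"] by (simp add: upt_conv_Cons del: upt_Suc)

text \<open>For \<open>s < n\<close> the exponent \<open>n\<close> is singled out in the last
  column, where the additive relation can be substituted.\<close>

lemma dickson_L_eq:
  "dickson_L n n = ydet [1..<n + 1] [0..<n]"
  "s < n \<Longrightarrow> dickson_L n s = ydet [1..<n + 1] ([0..<s] @ [s + 1..<n] @ [n])"
proof -
  have *: "filter (\<lambda>a. a \<noteq> s) [i..<j] = [i..<j]" if "\<not> (i \<le> s \<and> s < j)" for i j s :: nat
    using that by (intro filter_True) auto
  show "dickson_L n n = ydet [1..<n + 1] [0..<n]"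
    by (simp add: dickson_L_def *)
  assume "s < n"
  then have "[0..<n + 1] = [0..<s] @ s # [s + 1..<n] @ [n]"
    using upt_split_at[of s n] by simp
  then have "filter (\<lambda>a. a \<noteq> s) [0..<n + 1] = [0..<s] @ [s + 1..<n] @ [n]"
    using \<open>s < n\<close> by (simp add: *)
  then show "dickson_L n s = ydet [1..<n + 1] ([0..<s] @ [s + 1..<n] @ [n])"
    by (simp only: dickson_L_def)
qed

text \<open>In the Leibniz expansion the permutation \<pi> contributes the monomial in which y_(u+1)
  has exponent p^(\<pi> u). Since p > 1, the monomial determines \<pi>, so the diagonal one occurs
  only once, with coefficient 1.\<close>

lemma dickson_L_nonzero: "(dickson_L n n :: 'p::prime_card mod_ring ypoly) \<noteq> 0"
proof -
  let ?p = "CARD('p)"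
  have p: "1 < ?p" using prime_card[where 'a = 'p] by (rule prime_gt_1_nat)
  define m :: "(nat \<Rightarrow> nat) \<Rightarrow> nat \<Rightarrow>\<^sub>0 nat"
    where "m \<pi> = (\<Sum>u<n. Poly_Mapping.single (Suc u) (?p ^ \<pi> u))" for \<pi>
  have m: "Poly_Mapping.lookup (m \<pi>) (Suc u) = ?p ^ \<pi> u" if "u < n" for \<pi> u
    using that by (simp add: m_def lookup_sum lookup_single when_def)
  have neq: "m \<pi> \<noteq> m id" if "\<pi> permutes {0..<n}" "\<pi> \<noteq> id" for \<pi>
  proof
    assume eq: "m \<pi> = m id"
    obtain u where u: "\<pi> u \<noteq> u" using \<open>\<pi> \<noteq> id\<close> by (auto simp: fun_eq_iff)
    then have "u < n" using that(1) by (metis atLeastLessThan_iff permutes_not_in zero_le)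
    then have "?p ^ \<pi> u = ?p ^ u" using m[of u \<pi>] m[of u id] eq by simp
    then show False using u p by simp
  qed
  define A where "A = (ymat [1..<n + 1] [0..<n] :: 'p mod_ring ypoly mat)"
  have "A \<in> carrier_mat n n" by (simp add: A_def del: upt_Suc)
  then have "det A = (\<Sum>\<pi> | \<pi> permutes {0..<n}. signof \<pi> * (\<Prod>i = 0..<n. A $$ (i, \<pi> i)))"
    by (rule det_def')
  also have "\<dots> = (\<Sum>\<pi> | \<pi> permutes {0..<n}. signof \<pi> * Poly_Mapping.single (m \<pi>) 1)"
  proof (rule sum.cong[OF refl])
    fix \<pi> assume "\<pi> \<in> {\<pi>. \<pi> permutes {0..<n}}"
    then have "\<pi> u < n" if "u < n" for u using that permutes_in_image[of \<pi> "{0..<n}" u] by simp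
    then have "(\<Prod>i = 0..<n. A $$ (i, \<pi> i)) = (\<Prod>u<n. Poly_Mapping.single (Poly_Mapping.single (Suc u) (?p ^ \<pi> u)) 1)"
      by (intro prod.cong) (auto simp: A_def yvar_power simp del: upt_Suc)
    then show "signof \<pi> * (\<Prod>i = 0..<n. A $$ (i, \<pi> i)) = signof \<pi> * Poly_Mapping.single (m \<pi>) 1"
      by (simp add: prod_single_one m_def)
  qed
  finally have "Poly_Mapping.lookup (det A) (m id) = (\<Sum>\<pi> | \<pi> permutes {0..<n}.
      Poly_Mapping.lookup (signof \<pi> * Poly_Mapping.single (m \<pi>) (1 :: 'p mod_ring)) (m id))"
    by (simp only: lookup_sum)
  also have "\<dots> = (\<Sum>\<pi>\<in>{id}. Poly_Mapping.lookup (signof \<pi> * Poly_Mapping.single (m \<pi>) (1 :: 'p mod_ring)) (m id))"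
    using neq by (intro sum.mono_neutral_right)
      (auto simp: permutes_id finite_permutations sign_def lookup_single when_def)
  also have "\<dots> = 1" by simp
  finally have "ydet [1..<n + 1] [0..<n] \<noteq> (0 :: 'p mod_ring ypoly)"
    unfolding ydet_def A_def by auto
  then show ?thesis by (simp only: dickson_L_eq not_False_eq_True)
qed

text \<open>The additive polynomial expresses the column of \<open>n\<close> through the lower ones
  with coefficients \<open>- c r\<close>. Applied to the determinant L_{n,r} itself, this shows that
  L_{n,r} is \<open>c r\<close> times L_n up to sign, which identifies the coefficients with the
  Dickson invariants.\<close>

lemma ydet_last_column_dickson:
  assumes "length J = Suc (length xs)" "set J \<subseteq> {1..n}"
  shows "(ydet J (xs @ [n]) :: 'p::prime_card mod_ring ypoly) =
    (\<Sum>r<n. (-1) ^ (n - 1 - r) * dickson_Q n r * ydet J (xs @ [r]))"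
proof -
  let ?p = "CARD('p)"
  obtain c :: "nat \<Rightarrow> 'p mod_ring ypoly" where c: "c n = 1"
      "\<And>i. i \<in> {1..n} \<Longrightarrow> (\<Sum>s\<le>n. c s * yvar i ^ (?p ^ s)) = 0"
    using ex_additive_polynomial[of n] by blast
  have rel: "yvar i ^ (?p ^ n) = (\<Sum>r<n. - c r * yvar i ^ (?p ^ r))" if "i \<in> {1..n}" for i
    using c(2)[OF that]
    by (simp add: lessThan_Suc_atMost[symmetric] c(1) sum_negf eq_neg_iff_add_eq_0 add.commute)
  have lin: "ydet J (xs @ [n]) = (\<Sum>r<n. - c r * ydet J (xs @ [r]))"
    if "length J = Suc (length xs)" "set J \<subseteq> {1..n}" for J xs
    using that rel by (intro ydet_last_column_linear) auto
  have "(-1) ^ (n - 1 - r) * dickson_Q n r = - c r" if r: "r < n" for r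
  proof -
    let ?J = "[1..<n + 1]" and ?L = "dickson_L n n :: 'p mod_ring ypoly"
    have "dickson_L n r = ydet ?J (([0..<r] @ [r + 1..<n]) @ [n])"
      using r by (simp add: dickson_L_eq)
    also have "\<dots> = (\<Sum>s<n. - c s * ydet ?J (([0..<r] @ [r + 1..<n]) @ [s]))"
      using r by (intro lin) auto
    \<comment> \<open>Every \<open>s < n\<close> other than \<open>r\<close> already labels a
      column, so only the omitted exponent survives.\<close>
    also have "\<dots> = (\<Sum>s\<in>{r}. - c s * ydet ?J (([0..<r] @ [r + 1..<n]) @ [s]))"
    proof (rule sum.mono_neutral_right)
      show "\<forall>s\<in>{..<n} - {r}. - c s * ydet ?J (([0..<r] @ [r + 1..<n]) @ [s]) = 0"
      proof
        fix s assume "s \<in> {..<n} - {r}"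
        then have "\<not> distinct (([0..<r] @ [r + 1..<n]) @ [s])" by auto
        then have "(ydet ?J (([0..<r] @ [r + 1..<n]) @ [s]) :: 'p mod_ring ypoly) = 0"
          using r by (intro ydet_repeated_column) auto
        then show "- c s * ydet ?J (([0..<r] @ [r + 1..<n]) @ [s]) = 0" by simp
      qed
    qed (use r in auto)
    also have "\<dots> = - c r * ((-1) ^ (n - 1 - r) * ydet ?J ([0..<r] @ r # [r + 1..<n]))"
      using r ydet_move_column[of ?J "[0..<r]" "[r + 1..<n]" r, where 'p = 'p] by simp
    also have "[0..<r] @ r # [r + 1..<n] = [0..<n]"
      using upt_split_at[OF r] by simp
    finally have "dickson_L n r = - c r * (-1) ^ (n - 1 - r) * ?L" by (simp add: dickson_L_eq)
    \<comment> \<open>The identity just obtained exhibits a quotient and cancelling L_n makes it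
      unique, so the definite description in \<open>dickson_Q\<close> is determined.\<close>
    then have "q * ?L = dickson_L n r \<longleftrightarrow> q = - c r * (-1) ^ (n - 1 - r)" for q
      using dickson_L_nonzero[of n, where 'p = 'p] by (metis mult_right_cancel)
    then have "dickson_Q n r = - c r * (-1) ^ (n - 1 - r)"
      unfolding dickson_Q_def by simp
    then show ?thesis by (simp add: mult.left_commute flip: power_add mult_2)
  qed
  then show ?thesis unfolding lin[OF assms] by (intro sum.cong) auto
qed

section \<open>Signs of shuffles\<close>

lemma sorted_list_of_set_image_strict_mono:
  assumes "finite A" "strict_mono_on A f"
  shows "sorted_list_of_set (f ` A) = map f (sorted_list_of_set A :: 'a::linorder list)"
proof -
  have "sorted_wrt (\<lambda>x y. f x < f y) (sorted_list_of_set A)"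
    using assms by (intro sorted_wrt_mono_rel[OF _ strict_sorted_list_of_set])
      (auto simp: strict_mono_on_def)
  then have "sorted_wrt (<) (map f (sorted_list_of_set A))" by (simp add: sorted_wrt_map)
  then show ?thesis using assms(1) by (intro strict_sorted_equal) auto
qed

lemma shuffle_perm_permutes:
  assumes "I \<subseteq> {1..n}"
  shows "shuffle_perm n I permutes {1..n}"
proof (rule bij_imp_permutes)
  let ?l = "sorted_list_of_set I @ sorted_list_of_set ({1..n} - I)"
  have fin: "finite I" using assms finite_subset by blast
  have l: "distinct ?l" "set ?l = {1..n}" using assms fin by auto
  then have "length ?l = n" by (metis card_atLeastAtMost diff_Suc_1 distinct_card)
  then have "bij_betw ((!) ?l) {..<n} {1..n}"
    using l by (intro bij_betw_nth) auto
  moreover have "bij_betw (\<lambda>j. j - 1) {1..n} {..<n}"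
    by (rule bij_betw_byWitness[of _ Suc]) auto
  ultimately have "bij_betw (\<lambda>j. ?l ! (j - 1)) {1..n} {1..n}"
    using bij_betw_trans by (fastforce simp: comp_def)
  then show "bij_betw (shuffle_perm n I) {1..n} {1..n}"
    by (rule bij_betw_cong[THEN iffD1, rotated]) (simp add: shuffle_perm_def)
qed (auto simp: shuffle_perm_def)

text \<open>Induction on the sum of \<open>I\<close>. If \<open>i\<close> is outside and
  \<open>Suc i\<close> inside \<open>I\<close>, exchanging them lowers the sum, composes the
  permutation with a transposition and removes exactly the inversion \<open>(Suc i, i)\<close>. If
  there is no such \<open>i\<close>, then \<open>I\<close> is an initial segment and the permutation
  is the identity.\<close>

lemma sign_shuffle_perm_inversions:
  assumes "I \<subseteq> {1..n}"
  shows "sign (shuffle_perm n I) = (-1) ^ card {(i, j). i \<in> I \<and> j \<in> {1..n} - I \<and> j < i}"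
  using assms
proof (induction "\<Sum>I" arbitrary: I rule: less_induct)
  case less
  let ?inv = "\<lambda>I. {(i, j). i \<in> I \<and> j \<in> {1..n} - I \<and> j < i}"
  have fin: "finite I" using less.prems finite_subset by blast
  have fin_inv: "finite (?inv J)" if "J \<subseteq> {1..n}" for J
    using that by (intro finite_subset[of "?inv J" "{1..n} \<times> {1..n}"]) auto
  show ?case
  proof (cases "\<exists>i\<in>{1..<n}. i \<notin> I \<and> Suc i \<in> I")
    case True
    then obtain i where i: "1 \<le> i" "i < n" "i \<notin> I" "Suc i \<in> I" by auto
    define \<tau> where "\<tau> = transpose i (Suc i)"
    have \<tau>: "\<tau> i = Suc i" "\<tau> (Suc i) = i" "\<And>a. a \<noteq> i \<Longrightarrow> a \<noteq> Suc i \<Longrightarrow> \<tau> a = a"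
      by (auto simp: \<tau>_def)
    have \<tau>\<tau>: "\<tau> (\<tau> a) = a" for a by (simp add: \<tau>_def)
    \<comment> \<open>\<open>I\<close> contains only \<open>Suc i\<close> and its complement only
      \<open>i\<close>, so \<tau> is increasing on each of them and maps their sorted lists to
      sorted lists.\<close>
    have mono1: "strict_mono_on I \<tau>"
      using i(3) by (auto simp: strict_mono_on_def \<tau>_def transpose_def)
    have mono2: "strict_mono_on ({1..n} - I) \<tau>"
      using i(4) by (auto simp: strict_mono_on_def \<tau>_def transpose_def)
    have img: "\<tau> a \<in> {1..n} \<longleftrightarrow> a \<in> {1..n}" for a
      using i by (auto simp: \<tau>_def transpose_def)
    have imI: "a \<in> \<tau> ` X \<longleftrightarrow> \<tau> a \<in> X" for a X using \<tau>\<tau> by (metis imageE imageI)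
    have sub: "\<tau> ` I \<subseteq> {1..n}" using less.prems img by auto
    have compl: "{1..n} - \<tau> ` I = \<tau> ` ({1..n} - I)"
      by (rule Set.set_eqI) (simp only: Diff_iff imI img)
    have perm: "shuffle_perm n (\<tau> ` I) = \<tau> \<circ> shuffle_perm n I"
    proof
      fix j
      let ?l = "sorted_list_of_set I @ sorted_list_of_set ({1..n} - I)"
      have "card I \<le> n" using card_mono[OF _ less.prems] by simp
      then have "length ?l = n" using less.prems fin by (simp add: card_Diff_subset)
      moreover have "sorted_list_of_set (\<tau> ` I) @ sorted_list_of_set ({1..n} - \<tau> ` I) = map \<tau> ?l"
        using fin sorted_list_of_set_image_strict_mono[OF _ mono1]
          sorted_list_of_set_image_strict_mono[OF _ mono2]
        by (simp only: compl map_append finite_Diff finite_atLeastAtMost)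
      ultimately show "shuffle_perm n (\<tau> ` I) j = (\<tau> \<circ> shuffle_perm n I) j"
        unfolding shuffle_perm_def using i \<tau>(3)[of j]
        by (auto simp del: map_append One_nat_def)
    qed
    have "sum id (\<tau> ` I) < sum id I"
    proof -
      have "sum id (\<tau> ` I) = (\<Sum>a\<in>I. \<tau> a)"
        using mono1 by (subst sum.reindex) (auto intro: strict_mono_on_imp_inj_on)
      also have "\<dots> < (\<Sum>a\<in>I. a)"
        using fin i \<tau> by (intro sum_strict_mono_ex1) (metis Suc_le_eq le_refl less_imp_le_nat lessI)+
      finally show ?thesis by simp
    qed
    then have IH: "sign (shuffle_perm n (\<tau> ` I)) = (-1) ^ card (?inv (\<tau> ` I))"
      using sub by (intro less.hyps) auto
    have "permutation (shuffle_perm n I)" "permutation \<tau>"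
      using shuffle_perm_permutes[OF less.prems] permutation_permutes finite_atLeastAtMost
      by (blast, simp add: \<tau>_def permutation_swap_id)
    then have "sign (shuffle_perm n (\<tau> ` I)) = sign \<tau> * sign (shuffle_perm n I)"
      unfolding perm by (intro sign_compose)
    moreover have "sign \<tau> = - 1" by (simp add: \<tau>_def sign_swap_id)
    moreover have "card (?inv I) = Suc (card (?inv (\<tau> ` I)))"
    proof -
      have inv2: "map_prod \<tau> \<tau> (map_prod \<tau> \<tau> x) = x" for x by (cases x) (simp add: \<tau>\<tau>)
      have imP: "x \<in> map_prod \<tau> \<tau> ` X \<longleftrightarrow> map_prod \<tau> \<tau> x \<in> X" for x and X :: "(nat \<times> nat) set"
      proof
        assume "x \<in> map_prod \<tau> \<tau> ` X"
        then show "map_prod \<tau> \<tau> x \<in> X" using inv2 by (elim imageE) simp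
      qed (rule image_eqI[of _ _ "map_prod \<tau> \<tau> x"], simp only: inv2)
      have inv: "(a, b) \<in> map_prod \<tau> \<tau> ` ?inv (\<tau> ` I) \<longleftrightarrow> a \<in> I \<and> b \<in> {1..n} - I \<and> \<tau> b < \<tau> a" for a b
        unfolding imP by (simp only: map_prod_simp mem_Collect_eq prod.case imI Diff_iff \<tau>\<tau> img)
      \<comment> \<open>Among the pairs with first entry in \<open>I\<close> and second entry
        outside, only \<open>(Suc i, i)\<close> has its order reversed by \<tau>.\<close>
      have lt: "\<tau> b < \<tau> a \<longleftrightarrow> b < a \<and> \<not> (a = Suc i \<and> b = i)" if "a \<in> I" "b \<notin> I" for a b
        using that i(3,4) by (auto simp: \<tau>_def transpose_def)
      have "?inv I = insert (Suc i, i) (map_prod \<tau> \<tau> ` ?inv (\<tau> ` I))"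
      proof (rule Set.set_eqI)
        fix x :: "nat \<times> nat"
        obtain a b where x: "x = (a, b)" by (cases x)
        have "i \<in> {1..n}" using i by simp
        then show "x \<in> ?inv I \<longleftrightarrow> x \<in> insert (Suc i, i) (map_prod \<tau> \<tau> ` ?inv (\<tau> ` I))"
          unfolding x insert_iff inv using lt i(3,4) by auto
      qed
      moreover have "(Suc i, i) \<notin> map_prod \<tau> \<tau> ` ?inv (\<tau> ` I)"
        unfolding inv using \<tau> by simp
      moreover have "card (map_prod \<tau> \<tau> ` ?inv (\<tau> ` I)) = card (?inv (\<tau> ` I))"
        using \<tau>\<tau> by (intro card_image inj_on_inverseI[of _ "map_prod \<tau> \<tau>"]) auto
      ultimately show ?thesis using fin_inv[OF sub] by simp
    qed
    ultimately show ?thesis using IH by simp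
  next
    case False
    \<comment> \<open>Without such an \<open>i\<close>, membership in \<open>I\<close> descends step
      by step to 1.\<close>
    have down: "a \<in> I" if "b \<in> I" "1 \<le> a" "a \<le> b" for a b
      using that(3,1,2)
    proof (induction rule: inc_induct)
      case (step a)
      then have "Suc a \<in> I" by simp
      then show ?case using False less.prems step by fastforce
    qed
    then have "?inv I = {}" by fastforce
    then have 1: "card (?inv I) = 0" by (metis card.empty)
    have "sorted_wrt (<) (sorted_list_of_set I @ sorted_list_of_set ({1..n} - I))"
      using down fin by (auto simp: sorted_wrt_append not_less) (meson leI)
    then have "sorted_list_of_set I @ sorted_list_of_set ({1..n} - I) = [1..<n + 1]"
      using less.prems fin by (intro strict_sorted_equal) (auto simp del: upt_Suc)
    then have "shuffle_perm n I = id"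
      by (auto simp: shuffle_perm_def fun_eq_iff simp del: upt_Suc)
    then show ?thesis using 1 by simp
  qed
qed

text \<open>Identifies the sign in the definition of the brackets with the sign that arises from
  reordering anticommuting elements.\<close>

lemma sign_shuffle_perm:
  assumes "F |\<subseteq>| N" "fset N = {1..n}"
  shows "sign (shuffle_perm n (fset F)) = shuffle_sgn F (N |-| F)"
proof -
  have "inversions F (N |-| F) = {(i, j). i \<in> fset F \<and> j \<in> {1..n} - fset F \<and> j < i}"
    using assms(2) by (auto simp: inversions_def)
  moreover have "F |\<inter>| (N |-| F) = {||}" by auto
  moreover have "fset F \<subseteq> {1..n}" using assms by (metis less_eq_fset.rep_eq)
  ultimately show ?thesis by (simp add: shuffle_sgn_def sign_shuffle_perm_inversions)
qed

section \<open>Products of sums of anticommuting elements\<close>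

text \<open>A binomial expansion in which \<open>A\<close> records the factors that contribute
  \<open>a\<close>. Each chosen \<open>b i\<close> has to move right past the chosen
  \<open>a j\<close> with \<open>j\<close> larger, and the inversions of \<open>A\<close> against
  its complement count these moves.\<close>

lemma oprod_add:
  fixes a b :: "nat \<Rightarrow> 'r::ring_1"
  assumes "\<And>i j. b i * a j = - (a j * b i)"
  shows "oprod (\<lambda>i. a i + b i) J =
    (\<Sum>A | A |\<subseteq>| J. of_int (shuffle_sgn A (J |-| A)) * (oprod a A * oprod b (J |-| A)))"
proof (induction J rule: fset_min_induct)
  case empty
  have "{A. A |\<subseteq>| {||}} = {{||} :: nat fset}" by auto
  then show ?case by simp
next
  case (insert i J)
  have iJ: "i |\<notin>| J" using insert(1) by blast
  let ?g = "\<lambda>J A. of_int (shuffle_sgn A (J |-| A)) * (oprod a A * oprod b (J |-| A))"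
  have comm: "b i * oprod a A = of_int ((-1) ^ fcard A) * (oprod a A * b i)" for A
  proof (induction A rule: fset_min_induct)
    case (insert j A)
    then have "j |\<notin>| A" by blast
    have "b i * (a j * oprod a A) = - (a j * (b i * oprod a A))"
      using assms[of i j] by (simp flip: mult.assoc)
    also have "\<dots> = of_int ((-1) ^ fcard (finsert j A)) * (a j * oprod a A * b i)"
      using \<open>j |\<notin>| A\<close> by (simp add: insert(2) of_int_shift[of "a j"] mult.assoc fcard_finsert_disjoint del: of_int_power)
    finally show ?case using insert(1) by (simp add: oprod_insert_min)
  qed (simp add: fcard.rep_eq)
  have fin: "finite {A. A |\<subseteq>| J}"
    using finite_fset[of "fPow J"] by (rule finite_subset[rotated]) auto
  have split: "{A. A |\<subseteq>| finsert i J} = finsert i ` {A. A |\<subseteq>| J} \<union> {A. A |\<subseteq>| J}"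
  proof (rule Set.set_eqI)
    fix A
    show "A \<in> {A. A |\<subseteq>| finsert i J} \<longleftrightarrow> A \<in> finsert i ` {A. A |\<subseteq>| J} \<union> {A. A |\<subseteq>| J}"
    proof
      assume "A \<in> {A. A |\<subseteq>| finsert i J}"
      then have A: "A |\<subseteq>| finsert i J" by simp
      show "A \<in> finsert i ` {A. A |\<subseteq>| J} \<union> {A. A |\<subseteq>| J}"
      proof (cases "i |\<in>| A")
        case True
        then have "A = finsert i (A |-| {|i|})" by (simp add: finsert_absorb)
        moreover have "A |-| {|i|} |\<subseteq>| J" using A by blast
        ultimately show ?thesis by blast
      next
        case False
        then show ?thesis using A by blast
      qed
    qed blast
  qed
  have disj: "finsert i ` {A. A |\<subseteq>| J} \<inter> {A. A |\<subseteq>| J} = {}" using iJ by auto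
  have inj: "inj_on (finsert i) {A. A |\<subseteq>| J}" 
    using iJ by (intro inj_on_inverseI[of _ "\<lambda>A. A |-| {|i|}"]) auto
  have min: "\<And>j. j |\<in>| A \<Longrightarrow> i < j" if "A |\<subseteq>| J" for A using that insert(1) by auto
  have left: "?g (finsert i J) (finsert i A) = a i * ?g J A" if A: "A |\<subseteq>| J" for A
  proof -
    have 1: "finsert i J |-| finsert i A = J |-| A" using iJ by auto
    have "inversions (finsert i A) (J |-| A) = inversions A (J |-| A)"
      using insert(1) by (fastforce simp: inversions_def)
    then have "shuffle_sgn (finsert i A) (J |-| A) = shuffle_sgn A (J |-| A)"
      using iJ by (auto simp: shuffle_sgn_def)
    then show ?thesis
      by (simp add: 1 oprod_insert_min[OF min[OF A]] of_int_shift mult.assoc)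
  qed
  \<comment> \<open>The least element \<open>i\<close> now lies in the complement and forms an
    inversion with every element of \<open>A\<close>; this matches the sign in
    \<open>comm\<close>.\<close>
  have right: "?g (finsert i J) A = b i * ?g J A" if A: "A |\<subseteq>| J" for A
  proof -
    have 1: "finsert i J |-| A = finsert i (J |-| A)" using iJ A by auto
    have "inversions A (finsert i (J |-| A)) = (\<lambda>j. (j, i)) ` fset A \<union> inversions A (J |-| A)"
      using min[OF A] by (auto simp: inversions_def)
    moreover have "(\<lambda>j. (j, i)) ` fset A \<inter> inversions A (J |-| A) = {}"
      using iJ by (auto simp: inversions_def)
    moreover have "card ((\<lambda>j. (j, i)) ` fset A) = fcard A"
      by (simp add: card_image inj_on_def fcard.rep_eq)
    ultimately have "card (inversions A (finsert i (J |-| A))) = fcard A + card (inversions A (J |-| A))"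
      by (simp add: card_Un_disjoint)
    moreover have "i |\<notin>| A" using iJ A by auto
    ultimately have sgn: "shuffle_sgn A (finsert i (J |-| A)) = (-1) ^ fcard A * shuffle_sgn A (J |-| A)"
      by (auto simp: shuffle_sgn_def power_add)
    have "b i * ?g J A = of_int (shuffle_sgn A (J |-| A)) * (b i * oprod a A * oprod b (J |-| A))"
      by (simp add: of_int_shift mult.assoc)
    also have "\<dots> = of_int (shuffle_sgn A (finsert i (J |-| A))) * (oprod a A * (b i * oprod b (J |-| A)))"
      by (simp only: comm sgn of_int_mult mult.assoc mult.commute[of "(-1) ^ fcard A"])
    also have "b i * oprod b (J |-| A) = oprod b (finsert i (J |-| A))"
      using min by (intro oprod_insert_min[symmetric]) auto
    finally show ?thesis by (simp only: 1)
  qed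
  have "oprod (\<lambda>i. a i + b i) (finsert i J) = (a i + b i) * (\<Sum>A | A |\<subseteq>| J. ?g J A)"
    using insert by (simp add: oprod_insert_min)
  also have "\<dots> = (\<Sum>A | A |\<subseteq>| J. a i * ?g J A) + (\<Sum>A | A |\<subseteq>| J. b i * ?g J A)"
    by (simp only: distrib_right sum_distrib_left sum.distrib)
  also have "\<dots> = (\<Sum>A | A |\<subseteq>| J. ?g (finsert i J) (finsert i A)) + (\<Sum>A | A |\<subseteq>| J. ?g (finsert i J) A)"
    using left right by (intro arg_cong2[of _ _ _ _ "(+)"] sum.cong) auto
  also have "\<dots> = (\<Sum>A | A |\<subseteq>| finsert i J. ?g (finsert i J) A)"
    unfolding split using fin disj by (simp add: sum.union_disjoint sum.reindex[OF inj])
  finally show ?case .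
qed

section \<open>Laplace expansions with shuffle signs\<close>

text \<open>Translates between positions in a sorted list, which index Laplace expansions, and
  elements of a set, which index shuffle signs.\<close>

lemma sorted_list_of_set_Diff_nth:
  fixes xs :: "'a::linorder list"
  assumes "sorted_wrt (<) xs" "t < length xs"
  shows "sorted_list_of_set (set xs - {xs ! t}) = omit_nth t xs"
    and "card {x \<in> set xs. x < xs ! t} = t"
proof -
  have xs: "xs = take t xs @ xs ! t # drop (Suc t) xs" using assms(2) by (rule id_take_nth_drop)
  then have s: "sorted_wrt (<) (take t xs @ xs ! t # drop (Suc t) xs)" using assms(1) by metis
  then have "sorted_wrt (<) (omit_nth t xs)" by (auto simp: omit_nth_def sorted_wrt_append)
  moreover have "set xs = set (take t xs) \<union> {xs ! t} \<union> set (drop (Suc t) xs)"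
    using arg_cong[OF xs, of set] by simp
  ultimately show "sorted_list_of_set (set xs - {xs ! t}) = omit_nth t xs"
    using s by (intro strict_sorted_equal) (auto simp: omit_nth_def sorted_wrt_append)
  have "{x \<in> set xs. x < xs ! t} = set (take t xs)"
    using s \<open>set xs = _\<close> by (auto simp: sorted_wrt_append)
  moreover have "distinct xs" using assms(1) by (simp add: strict_sorted_iff)
  ultimately show "card {x \<in> set xs. x < xs ! t} = t"
    using assms(2) by (simp add: distinct_card)
qed

lemma shuffle_sgn_singleton_left:
  assumes "s |\<in>| T"
  shows "shuffle_sgn {|s|} (T |-| {|s|}) = (-1) ^ card {x \<in> fset T. x < s}"
proof -
  have "inversions {|s|} (T |-| {|s|}) = Pair s ` {x \<in> fset T. x < s}"
    by (auto simp: inversions_def)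
  then show ?thesis by (auto simp: shuffle_sgn_def card_image inj_on_def)
qed

lemma shuffle_sgn_singleton_right:
  assumes "s |\<in>| T"
  shows "shuffle_sgn (T |-| {|s|}) {|s|} = (-1) ^ card {x \<in> fset T. s < x}"
proof -
  have "inversions (T |-| {|s|}) {|s|} = (\<lambda>x. (x, s)) ` {x \<in> fset T. s < x}"
    by (auto simp: inversions_def)
  moreover have "(T |-| {|s|}) |\<inter>| {|s|} = {||}" by blast
  ultimately show ?thesis by (simp add: shuffle_sgn_def card_image inj_on_def)
qed

abbreviation flist :: "nat fset \<Rightarrow> nat list" where
  "flist T \<equiv> sorted_list_of_set (fset T)"

declare fcard_fempty [simp]

lemma card_fset [simp]: "card (fset T) = fcard T"
  by (simp only: fcard.rep_eq)

lemma sum_fset_nth: "(\<Sum>s\<in>fset T. f s) = (\<Sum>t<fcard T. f (flist T ! t))"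
  by (rule sum.reindex_bij_betw[symmetric], rule bij_betw_nth) auto

lemma flist_nth:
  assumes "t < fcard T"
  shows "flist T ! t |\<in>| T" "flist (T |-| {|flist T ! t|}) = omit_nth t (flist T)"
    and "card {x \<in> fset T. x < flist T ! t} = t" "card {x \<in> fset T. flist T ! t < x} = fcard T - 1 - t"
proof -
  have l: "sorted_wrt (<) (flist T)" "t < length (flist T)" using assms by simp_all
  have mem: "flist T ! t \<in> fset T" using nth_mem[OF l(2)] by simp
  then show "flist T ! t |\<in>| T" .
  show "flist (T |-| {|flist T ! t|}) = omit_nth t (flist T)"
    using sorted_list_of_set_Diff_nth(1)[OF l] by simp
  show less: "card {x \<in> fset T. x < flist T ! t} = t"
    using sorted_list_of_set_Diff_nth(2)[OF l] by simp
  have "fset T = insert (flist T ! t) ({x \<in> fset T. x < flist T ! t} \<union> {x \<in> fset T. flist T ! t < x})"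
    using mem by auto
  then have "fcard T = card (insert (flist T ! t) ({x \<in> fset T. x < flist T ! t} \<union> {x \<in> fset T. flist T ! t < x}))"
    by (simp only: fcard.rep_eq)
  also have "\<dots> = Suc (t + card {x \<in> fset T. flist T ! t < x})"
    by (subst card_insert_disjoint, simp, force, subst card_Un_disjoint) (auto simp: less)
  finally show "card {x \<in> fset T. flist T ! t < x} = fcard T - 1 - t" by simp
qed

text \<open>Exactly \<open>t\<close> elements of \<open>T\<close> are smaller than the one at
  position \<open>t\<close>, counted from 0, so the Laplace sign along the first row is a shuffle
  sign.\<close>

lemma ydet_expand_row_fset:
  assumes "fcard T = Suc (length J)"
  shows "(ydet (i # J) (flist T) :: 'p::prime_card mod_ring ypoly) =
    (\<Sum>s\<in>fset T. of_int (shuffle_sgn {|s|} (T |-| {|s|})) * yvar i ^ (CARD('p) ^ s) * ydet J (flist (T |-| {|s|})))"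
proof -
  have "ydet (i # J) (flist T) = (\<Sum>t<fcard T. (-1) ^ t * yvar i ^ (CARD('p) ^ (flist T ! t)) *
      (ydet J (omit_nth t (flist T)) :: 'p mod_ring ypoly))"
    using ydet_expand_row[of "flist T" J i, where 'p = 'p] assms by simp
  also have "\<dots> = (\<Sum>t<fcard T. of_int (shuffle_sgn {|flist T ! t|} (T |-| {|flist T ! t|})) *
      yvar i ^ (CARD('p) ^ (flist T ! t)) * ydet J (flist (T |-| {|flist T ! t|})))"
    by (intro sum.cong refl)
       (simp only: lessThan_iff flist_nth shuffle_sgn_singleton_left of_int_power of_int_minus of_int_1)
  finally show ?thesis by (simp only: sum_fset_nth)
qed

text \<open>In the last column the Laplace sign counts, modulo 2, the rows after the deleted one,
  that is, the elements of \<open>C\<close> larger than \<open>j\<close>.\<close>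

lemma ydet_expand_column_fset:
  assumes "fcard C = Suc (length a)"
  shows "(ydet (flist C) (a @ [s]) :: 'p::prime_card mod_ring ypoly) =
    (\<Sum>j\<in>fset C. of_int (shuffle_sgn (C |-| {|j|}) {|j|}) * yvar j ^ (CARD('p) ^ s) * ydet (flist (C |-| {|j|})) a)"
proof -
  have "ydet (flist C) (a @ [s]) = (\<Sum>i<fcard C. (-1) ^ (i + length a) * yvar (flist C ! i) ^ (CARD('p) ^ s) *
      (ydet (omit_nth i (flist C)) a :: 'p mod_ring ypoly))"
    using ydet_expand_column[of "flist C" a "[]" s, where 'p = 'p] assms by simp
  also have "\<dots> = (\<Sum>i<fcard C. of_int (shuffle_sgn (C |-| {|flist C ! i|}) {|flist C ! i|}) *
      yvar (flist C ! i) ^ (CARD('p) ^ s) * ydet (flist (C |-| {|flist C ! i|})) a)"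
  proof (intro sum.cong refl)
    fix i assume "i \<in> {..<fcard C}"
    then have i: "i < fcard C" by simp
    then have "i + length a + (fcard C - 1 - i) = 2 * length a" using assms by simp
    then have "(-1) ^ (i + length a) = ((-1) ^ (fcard C - 1 - i) :: 'p mod_ring ypoly)"
      by (intro minus_one_power_cong) (simp only: dvd_triv_left)
    then show "(-1) ^ (i + length a) * yvar (flist C ! i) ^ (CARD('p) ^ s) * (ydet (omit_nth i (flist C)) a :: 'p mod_ring ypoly) =
        of_int (shuffle_sgn (C |-| {|flist C ! i|}) {|flist C ! i|}) *
        yvar (flist C ! i) ^ (CARD('p) ^ s) * ydet (flist (C |-| {|flist C ! i|})) a"
      using i by (simp only: flist_nth shuffle_sgn_singleton_right of_int_power of_int_minus of_int_1)
  qed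
  finally show ?thesis by (simp only: sum_fset_nth)
qed


section \<open>The coaction on the brackets\<close>

lemma hpoly_sum: "hpoly (sum f A) = (\<Sum>a\<in>A. hpoly (f a))"
  by (induction A rule: infinite_finite_induct) (simp_all add: hpoly_add)

section \<open>Coefficients of the coaction on products of generators\<close>

text \<open>Splitting off the part of \<open>lam_x i\<close> that involves the \<tau> presents it as
  a sum of two terms to which the binomial expansion \<open>oprod_add\<close> applies.\<close>

definition lam_tau :: "nat \<Rightarrow> 'p::prime_card mod_ring tens" where
  "lam_tau i = tsum (\<lambda>s. tmono {|s|} 0 (ygen i ^ (CARD('p) ^ s)))"

lemma lam_x_eq: "lam_x i = tmono {||} 0 (xgen i) + lam_tau i"
  by (simp add: lam_x_def lam_tau_def)

lemma tcoef_lam_tau: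
  "tcoef (lam_tau i :: 'p::prime_card mod_ring tens) ({|s|}, 0) = ygen i ^ (CARD('p) ^ s)"
  "(\<And>s. m \<noteq> ({|s|}, 0)) \<Longrightarrow> tcoef (lam_tau i) m = 0"
proof -
  show "tcoef (lam_tau i :: 'p mod_ring tens) ({|s|}, 0) = ygen i ^ (CARD('p) ^ s)"
    unfolding lam_tau_def tsum_def tcoef_Abs_tens
    by (subst Sum_any.expand_superset[of "{s}"]) auto
  show "tcoef (lam_tau i) m = 0" if "\<And>s. m \<noteq> ({|s|}, 0)"
    unfolding lam_tau_def tsum_def using that by simp
qed

text \<open>Both elements have odd total degree: \<open>xgen j\<close> by itself, each term of
  \<open>lam_tau i\<close> through its single \<tau>.\<close>

lemma lam_tau_anticommute: "lam_tau i * tmono {||} 0 (xgen j) = - (tmono {||} 0 (xgen j) * lam_tau i)"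
proof -
  have "tens_parity 1 (tmono {||} 0 (xgen j))"
    by (intro tens_parity_tmono coh_parity_xgen) simp
  moreover have "tens_parity 1 (lam_tau i)"
    unfolding lam_tau_def ygen_def hpoly_power[symmetric]
    by (intro tens_parity_tsum tens_parity_tmono coh_parity_hpoly) (simp add: fcard_finsert_disjoint)
  ultimately show ?thesis using tens_commute by fastforce
qed

lemma oprod_tmono_xgen: "oprod (\<lambda>i. tmono {||} 0 (xgen i)) A = tmono {||} 0 (hmono A 1)"
proof -
  have "oprod (\<lambda>i. tmono {||} 0 (xgen i)) A = tmono {||} 0 (oprod xgen A)"
  proof (induction A rule: fset_min_induct)
    case empty
    then show ?case by simp
  next
    case (insert i A)
    then show ?case by (simp add: oprod_insert_min tmono_mult)
  qed
  then show ?thesis by (simp add: oprod_xgen)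
qed

text \<open>The left factor supplies one \<tau>_s with \<open>s\<close> in \<open>T\<close>, and
  \<open>g\<close> the remaining ones; \<open>twist 1\<close> is the Koszul sign of moving \<tau>_s
  past the coefficient of \<open>g\<close>.\<close>

lemma tcoef_lam_tau_mult:
  fixes g :: "'p::prime_card mod_ring tens"
  shows "tcoef (lam_tau i * g) (T, R) = (\<Sum>s\<in>fset T. of_int (shuffle_sgn {|s|} (T |-| {|s|})) *
    (ygen i ^ (CARD('p) ^ s) * twist 1 (tcoef g (T |-| {|s|}, R))))"
proof -
  let ?h = "\<lambda>s. (({|s|}, 0 :: nat \<Rightarrow>\<^sub>0 nat), (T |-| {|s|}, R))"
  let ?F = "\<lambda>(a, b). of_int (idx_sgn a b) * (tcoef (lam_tau i) a * twist (fcard (fst a)) (tcoef g b))"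
  have sub: "?h ` fset T \<subseteq> {(a, b). idx_add a b = (T, R)}"
    by (auto simp: idx_add_def finsert_absorb)
  have zero: "?F x = 0" if x: "x \<in> {(a, b). idx_add a b = (T, R)} - ?h ` fset T" for x
  proof (cases "\<exists>s. fst x = ({|s|}, 0)")
    case True
    then obtain s B R' where xs: "x = (({|s|}, 0), (B, R'))" by (metis prod.collapse)
    then have T: "T = finsert s B" "R' = R" using x by (auto simp: idx_add_def)
    \<comment> \<open>Outside the image of \<open>?h\<close> the same \<open>s\<close> occurs in
      both factors, and the square of \<tau>_s is zero.\<close>
    then have "s |\<in>| B" using x xs by (cases "s |\<in>| B") auto
    then have "shuffle_sgn {|s|} B = 0" by (auto simp: shuffle_sgn_def)
    then show ?thesis by (simp add: xs idx_sgn_def)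
  next
    case False
    then have "tcoef (lam_tau i :: 'p mod_ring tens) (fst x) = 0" by (intro tcoef_lam_tau(2)) auto
    then show ?thesis by (simp add: split_def)
  qed
  have "tcoef (lam_tau i * g) (T, R) = (\<Sum>x\<in>?h ` fset T. ?F x)"
    unfolding tcoef_times using sub zero by (intro sum.mono_neutral_right) auto
  also have "\<dots> = (\<Sum>s\<in>fset T. ?F (?h s))"
    by (subst sum.reindex) (auto simp: inj_on_def)
  finally show ?thesis by (simp add: idx_sgn_def tcoef_lam_tau fcard_finsert_disjoint)
qed

lemma flist_finsert_min:
  assumes "\<And>j. j |\<in>| B \<Longrightarrow> i < j"
  shows "flist (finsert i B) = i # flist B"
  using assms by (intro strict_sorted_equal) (auto simp del: sorted_list_of_set_insert_remove simp: set_sorted_list_of_set)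

text \<open>Splitting off the factor of least index turns \<open>tcoef_lam_tau_mult\<close> into the
  Laplace expansion along the first row; the twists disappear because the coefficients are
  polynomials in the y.\<close>

lemma tcoef_oprod_lam_tau:
  "tcoef (oprod lam_tau B :: 'p::prime_card mod_ring tens) (T, R) =
    (if R = 0 \<and> fcard T = fcard B then hpoly (ydet (flist B) (flist T)) else 0)"
proof (induction B arbitrary: T R rule: fset_min_induct)
  case empty
  have "fcard T = 0 \<longleftrightarrow> T = {||}" by (rule fcard_0_eq)
  then show ?case by auto
next
  case (insert i B)
  have "i |\<notin>| B" using insert(1) by blast
  then have card: "fcard (finsert i B) = Suc (fcard B)" by (simp add: fcard_finsert_disjoint)
  have cardT: "Suc (fcard (T |-| {|s|})) = fcard T" if "s |\<in>| T" for s
    using that by (metis fcard_Suc_fminus1)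
  have eq: "tcoef (oprod lam_tau (finsert i B)) (T, R) =
      (\<Sum>s\<in>fset T. of_int (shuffle_sgn {|s|} (T |-| {|s|})) *
        (ygen i ^ (CARD('p) ^ s) * (if R = 0 \<and> fcard (T |-| {|s|}) = fcard B
           then hpoly (ydet (flist B) (flist (T |-| {|s|}))) else (0 :: 'p mod_ring coh))))"
    using insert(1) by (auto simp: oprod_insert_min tcoef_lam_tau_mult insert(2) intro!: sum.cong)
  show ?case
  proof (cases "R = 0 \<and> fcard T = fcard (finsert i B)")
    case False
    then have "\<not> (R = 0 \<and> fcard (T |-| {|s|}) = fcard B)" if "s |\<in>| T" for s
      using cardT[OF that] card by auto
    then show ?thesis unfolding eq if_not_P[OF False]
      by (intro sum.neutral ballI) (simp only: if_False mult_zero_right)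
  next
    case True
    then have "fcard (T |-| {|s|}) = fcard B" if "s |\<in>| T" for s
      using cardT[OF that] card by simp
    then have "tcoef (oprod lam_tau (finsert i B)) (T, R) =
        (\<Sum>s\<in>fset T. hpoly (of_int (shuffle_sgn {|s|} (T |-| {|s|})) * yvar i ^ (CARD('p) ^ s) *
          (ydet (flist B) (flist (T |-| {|s|})) :: 'p mod_ring ypoly)))"
      unfolding eq using True
      by (intro sum.cong refl) (simp add: of_int_coh hpoly_mult hpoly_power ygen_def mult.assoc)
    also have "\<dots> = hpoly (ydet (i # flist B) (flist T))"
      using True card by (subst ydet_expand_row_fset) (simp_all add: hpoly_sum)
    finally show ?thesis using True flist_finsert_min[OF insert(1)] by simp
  qed
qed

text \<open>Ensures that no two terms of \<open>lam_y\<close> fall into the same coefficient;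
  \<xi>_0 = 1 has the zero exponent.\<close>

lemma xi_exp_eq_iff [simp]: "xi_exp s = xi_exp s' \<longleftrightarrow> s = s'"
proof -
  have "Poly_Mapping.lookup (xi_exp s) i = (if s = Suc i then 1 else 0)" for s i
    by (auto simp: xi_exp_def lookup_single when_def)
  then show ?thesis by (metis not0_implies_Suc zero_neq_one)
qed

lemma tcoef_lam_y:
  "tcoef (lam_y i :: 'p::prime_card mod_ring tens) ({||}, xi_exp s) = ygen i ^ (CARD('p) ^ s)"
  "(\<And>s. m \<noteq> ({||}, xi_exp s)) \<Longrightarrow> tcoef (lam_y i) m = 0"
proof -
  show "tcoef (lam_y i :: 'p mod_ring tens) ({||}, xi_exp s) = ygen i ^ (CARD('p) ^ s)"
    unfolding lam_y_def tsum_def tcoef_Abs_tens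
    by (subst Sum_any.expand_superset[of "{s}"]) auto
  show "tcoef (lam_y i) m = 0" if "\<And>s. m \<noteq> ({||}, xi_exp s)"
    unfolding lam_y_def tsum_def using that by simp
qed

text \<open>By assumption \<open>g\<close> involves no \<xi>, and \<open>lam_y i\<close> involves no
  \<tau>, so all of \<tau>_T must come from \<open>g\<close> and the whole exponent of \<xi> from
  \<open>lam_y i\<close>.\<close>

lemma tcoef_mult_lam_y:
  fixes g :: "'p::prime_card mod_ring tens"
  assumes g: "\<And>T R. R \<noteq> 0 \<Longrightarrow> tcoef g (T, R) = 0"
  shows "tcoef (g * lam_y i) (T, xi_exp s) = tcoef g (T, 0) * ygen i ^ (CARD('p) ^ s)"
    and "(\<And>s. R \<noteq> xi_exp s) \<Longrightarrow> tcoef (g * lam_y i) (T, R) = 0"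
proof -
  have *: "tcoef (g * lam_y i) (T, R) = tcoef g (T, 0) * twist (fcard T) (tcoef (lam_y i) ({||}, R))" for T R
  proof -
    let ?F = "\<lambda>(a, b). of_int (idx_sgn a b) * (tcoef g a * twist (fcard (fst a)) (tcoef (lam_y i) b))"
    have "tcoef (g * lam_y i) (T, R) = sum ?F {((T, 0), ({||}, R))}"
      unfolding tcoef_times
    proof (rule sum.mono_neutral_right[OF finite_idx_fibre])
      show "\<forall>x\<in>{(a, b). idx_add a b = (T, R)} - {((T, 0), ({||}, R))}. ?F x = 0"
      proof
        fix x assume x: "x \<in> {(a, b). idx_add a b = (T, R)} - {((T, 0), ({||}, R))}"
        obtain S Q S' Q' where xs: "x = ((S, Q), (S', Q'))" by (metis prod.collapse)
        have "tcoef g (S, Q) = 0 \<or> tcoef (lam_y i :: 'p mod_ring tens) (S', Q') = 0"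
        proof (cases "Q = 0")
          case True
          then have "S' \<noteq> {||}" using x xs by (auto simp: idx_add_def)
          then show ?thesis by (intro disjI2 tcoef_lam_y(2)) simp
        qed (simp add: g)
        then show "?F x = 0" by (auto simp: xs)
      qed
    qed (simp add: idx_add_def)
    then show ?thesis by (simp add: idx_sgn_def)
  qed
  show "tcoef (g * lam_y i) (T, xi_exp s) = tcoef g (T, 0) * ygen i ^ (CARD('p) ^ s)"
    unfolding * tcoef_lam_y(1) by (simp add: ygen_def flip: hpoly_power)
  show "tcoef (g * lam_y i) (T, R) = 0" if "\<And>s. R \<noteq> xi_exp s"
    unfolding * using that by (subst tcoef_lam_y(2)) auto
qed

lemma of_int_mult_hmono: "of_int c * hmono I f = hmono I (of_int c * f)"
  by (simp add: of_int_coh hpoly_def hmono_mult)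

lemma hmono_mult_hpoly: "hmono I f * hpoly g = hmono I (f * g)"
  by (simp add: hpoly_def hmono_mult)

lemma hmono_sum: "hmono I (sum f A) = (\<Sum>a\<in>A. hmono I (f a))"
  by (induction A rule: infinite_finite_induct) (simp_all add: hmono_add)

text \<open>Here \<open>A\<close> is the set of factors that contribute their \<open>xgen\<close>;
  the others have to supply all of \<tau>_T, which gives the cardinality condition and the
  determinant.\<close>

lemma tcoef_oprod_lam_x:
  "tcoef (oprod lam_x J :: 'p::prime_card mod_ring tens) (T, R) =
    (\<Sum>A | A |\<subseteq>| J. if R = 0 \<and> fcard T = fcard (J |-| A)
      then hmono A (of_int (shuffle_sgn A (J |-| A)) * ydet (flist (J |-| A)) (flist T)) else 0)"
proof -
  let ?x = "\<lambda>i. tmono {||} 0 (xgen i) :: 'p mod_ring tens"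
  have "(oprod lam_x J :: 'p mod_ring tens) = oprod (\<lambda>i. ?x i + lam_tau i) J"
    by (rule arg_cong[of _ _ "\<lambda>f. oprod f J"]) (simp add: fun_eq_iff lam_x_eq)
  also have "\<dots> = (\<Sum>A | A |\<subseteq>| J. of_int (shuffle_sgn A (J |-| A)) * (oprod ?x A * oprod lam_tau (J |-| A)))"
    by (rule oprod_add) (rule lam_tau_anticommute)
  finally have "tcoef (oprod lam_x J :: 'p mod_ring tens) (T, R) =
      (\<Sum>A | A |\<subseteq>| J. of_int (shuffle_sgn A (J |-| A)) * (hmono A 1 *
        (if R = 0 \<and> fcard T = fcard (J |-| A) then hpoly (ydet (flist (J |-| A)) (flist T)) else 0)))"
    by (simp only: oprod_tmono_xgen tcoef_sum tcoef_of_int_mult tcoef_tmono0_mult tcoef_oprod_lam_tau)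
  also have "\<dots> = (\<Sum>A | A |\<subseteq>| J. if R = 0 \<and> fcard T = fcard (J |-| A)
      then hmono A (of_int (shuffle_sgn A (J |-| A)) * ydet (flist (J |-| A)) (flist T)) else 0)"
    by (intro sum.cong refl) (simp add: hmono_mult_hpoly of_int_mult_hmono)
  finally show ?thesis .
qed

section \<open>The coaction on the bracket [n - 1; 0]\<close>

text \<open>Passes to the normal form \<open>hmono\<close>, in which coefficients are unique and the
  sign is a shuffle sign.\<close>

lemma mui_bracket_eq:
  assumes "fset N = {1..n}"
  shows "(mui_bracket n k a :: 'p::prime_card mod_ring coh) = (\<Sum>F | F |\<subseteq>| N \<and> fcard F = k.
    hmono F (of_int (shuffle_sgn F (N |-| F)) * ydet (flist (N |-| F)) a))"
  unfolding mui_bracket_def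
proof (rule sum.reindex_bij_witness[of _ fset Abs_fset])
  have inv: "fset (Abs_fset I) = I" if "I \<subseteq> {1..n}" for I
    using that finite_subset by (intro Abs_fset_inverse) auto
  fix I assume "I \<in> {I. I \<subseteq> {1..n} \<and> card I = k}"
  then have I: "I \<subseteq> {1..n}" "card I = k" by auto
  note inv = inv[OF I(1)]
  show "fset (Abs_fset I) = I" by (rule inv)
  have sub: "Abs_fset I |\<subseteq>| N" using I inv assms by (simp add: less_eq_fset.rep_eq)
  show "Abs_fset I \<in> {F. F |\<subseteq>| N \<and> fcard F = k}" using sub I inv by (simp add: fcard.rep_eq del: card_fset)
  have "prod_list (map xgen (sorted_list_of_set I)) = (hmono (Abs_fset I) 1 :: 'p mod_ring coh)"
    unfolding oprod_xgen[symmetric] oprod_def inv ..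
  moreover have "sign (shuffle_perm n I) = shuffle_sgn (Abs_fset I) (N |-| Abs_fset I)"
    using sign_shuffle_perm[OF sub assms] by (simp only: inv)
  moreover have "fset (N |-| Abs_fset I) = {1..n} - I" by (simp add: inv assms)
  ultimately show "hmono (Abs_fset I) (of_int (shuffle_sgn (Abs_fset I) (N |-| Abs_fset I)) *
      ydet (flist (N |-| Abs_fset I)) a) =
      of_int (sign (shuffle_perm n I)) * prod_list (map xgen (sorted_list_of_set I)) *
      (hpoly (ydet (sorted_list_of_set ({1..n} - I)) a) :: 'p mod_ring coh)"
    by (simp add: of_int_mult_hmono hmono_mult_hpoly)
next
  fix F assume F: "F \<in> {F. F |\<subseteq>| N \<and> fcard F = k}"
  show "Abs_fset (fset F) = F" by (rule fset_inverse)
  show "fset F \<in> {I. I \<subseteq> {1..n} \<and> card I = k}"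
    using F assms by (simp add: less_eq_fset.rep_eq)
qed

lemma lam_of_int: "lam (of_int c) = of_int c"
  by (simp add: of_int_coh[where 'a = "'p::prime_card mod_ring"] lam_hpoly lam_poly_of_int)

text \<open>A subset of size \<open>n - 1\<close> omits a single \<open>j\<close>, so the
  determinant reduces to the entry y_j, and \<open>lam\<close> is multiplicative for odd p.\<close>

lemma lam_mui_bracket_corank_one:
  assumes "odd CARD('p::prime_card)" "fset N = {1..n}" "1 \<le> n"
  shows "lam (mui_bracket n (n - 1) [0] :: 'p mod_ring coh) = (\<Sum>j\<in>{1..n}.
    of_int (shuffle_sgn (N |-| {|j|}) {|j|}) * (oprod lam_x (N |-| {|j|}) * lam_y j))"
proof -
  have N: "fcard N = n" using assms(2) by (simp add: fcard.rep_eq del: card_fset)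
  have "(mui_bracket n (n - 1) [0] :: 'p mod_ring coh) = (\<Sum>F | F |\<subseteq>| N \<and> fcard F = n - 1.
      hmono F (of_int (shuffle_sgn F (N |-| F)) * ydet (flist (N |-| F)) [0]))"
    by (rule mui_bracket_eq[OF assms(2)])
  also have "\<dots> = (\<Sum>j\<in>{1..n}. of_int (shuffle_sgn (N |-| {|j|}) {|j|}) *
      (hmono (N |-| {|j|}) 1 * ygen j))"
  proof -
    have img: "{F. F |\<subseteq>| N \<and> fcard F = n - 1} = (\<lambda>j. N |-| {|j|}) ` {1..n}"
    proof (intro equalityI subsetI)
      fix F assume "F \<in> {F. F |\<subseteq>| N \<and> fcard F = n - 1}"
      then have F: "F |\<subseteq>| N" "fcard F = n - 1" by auto
      then have "fcard (N |-| F) = 1" using N assms(3) by (simp add: fcard_funion_fsubset)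
      then obtain j where "fset (N |-| F) = {j}"
        unfolding fcard.rep_eq by (rule card_1_singletonE)
      then have j: "N |-| F = {|j|}" by (simp add: fset_inject[symmetric])
      then have "F = N |-| {|j|}" using F(1) by blast
      moreover have "j \<in> {1..n}" using j assms(2) by blast
      ultimately show "F \<in> (\<lambda>j. N |-| {|j|}) ` {1..n}" by blast
    next
      fix F assume "F \<in> (\<lambda>j. N |-| {|j|}) ` {1..n}"
      then obtain j where "j |\<in>| N" "F = N |-| {|j|}" using assms(2) by blast
      then show "F \<in> {F. F |\<subseteq>| N \<and> fcard F = n - 1}"
        using N by (auto simp: fcard_fminus_fsingleton)
    qed
    have inv: "N |-| (N |-| {|j|}) = {|j|}" if "j \<in> {1..n}" for j
      using that assms(2) by blast
    then have "inj_on (\<lambda>j. N |-| {|j|}) {1..n}" by (intro inj_onI) (metis fsingleton_inject)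
    moreover have "ydet (flist {|j|}) [0] = (yvar j :: 'p mod_ring ypoly)" for j
      using ydet_expand_row[of "[0]" "[]" j, where 'p = 'p] by (simp add: omit_nth_Cons)
    ultimately show ?thesis
      unfolding img
      by (subst sum.reindex)
        (simp_all only: o_def inv ygen_def hmono_mult_hpoly of_int_mult_hmono mult_1_left cong: sum.cong)
  qed
  finally have "(mui_bracket n (n - 1) [0] :: 'p mod_ring coh) = \<dots>" .
  then show ?thesis
    by (simp add: lam_sum lam_mult[OF assms(1)] lam_of_int lam_hmono lam_ygen)
qed

text \<open>Fix the set \<open>A\<close> of indices whose x survives. The omitted index
  \<open>j\<close> runs over the complement of \<open>A\<close>, and the terms it contributes form
  the expansion of the determinant with columns \<open>flist T @ [s]\<close> down its last
  column.\<close>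

lemma tcoef_lam_mui_bracket:
  assumes odd: "odd CARD('p::prime_card)" and card: "k + fcard T + 1 = n"
  defines "u \<equiv> mui_bracket n (n - 1) [0] :: 'p mod_ring coh"
  shows "tcoef (lam u) (T, xi_exp s) = mui_bracket n k (flist T @ [s])"
    and "(\<And>s. R \<noteq> xi_exp s) \<Longrightarrow> tcoef (lam u) (T, R) = 0"
proof -
  define N where "N = fset_of_list [1..<n + 1]"
  have N: "fset N = {1..n}" by (auto simp: N_def fset_of_list.rep_eq)
  have cN: "fcard N = n" by (simp add: fcard.rep_eq N del: card_fset)
  have lam: "tcoef (lam u) (T, R) = (\<Sum>j\<in>{1..n}. of_int (shuffle_sgn (N |-| {|j|}) {|j|}) *
      tcoef (oprod lam_x (N |-| {|j|}) * lam_y j) (T, R))" for R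
    unfolding u_def using card
    by (subst lam_mui_bracket_corank_one[OF odd N]) (simp_all add: tcoef_of_int_mult)
  have supp: "tcoef (oprod lam_x J :: 'p mod_ring tens) (T, R) = 0" if "R \<noteq> 0" for J T R
    using that by (simp add: tcoef_oprod_lam_x)
  show "tcoef (lam u) (T, R) = 0" if "\<And>s. R \<noteq> xi_exp s"
    unfolding lam using that by (simp add: tcoef_mult_lam_y(2)[OF supp])
  have mult_y: "tcoef (oprod lam_x J * lam_y j) (T, xi_exp s) =
      tcoef (oprod lam_x J) (T, 0) * (ygen j ^ (CARD('p) ^ s) :: 'p mod_ring coh)" for J j
    by (rule tcoef_mult_lam_y(1)) (rule supp)
  let ?D = "\<lambda>C. ydet (flist C) (flist T) :: 'p mod_ring ypoly"
  let ?y = "\<lambda>j. yvar j ^ (CARD('p) ^ s) :: 'p mod_ring ypoly"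
  let ?G = "\<lambda>j A. hmono A (of_int (shuffle_sgn A (N |-| A)) *
      (of_int (shuffle_sgn (N |-| A |-| {|j|}) {|j|}) * ?y j * ?D (N |-| A |-| {|j|})))"
  have fin: "finite {A. A |\<subseteq>| J \<and> P A}" for J :: "nat fset" and P
    using finite_fset[of "fPow J"] by (rule finite_subset[rotated]) auto
  have term_eq: "of_int (shuffle_sgn (N |-| {|j|}) {|j|}) * tcoef (oprod lam_x (N |-| {|j|}) * lam_y j) (T, xi_exp s) =
      (\<Sum>A | A \<in> {A. A |\<subseteq>| N \<and> fcard A = k} \<and> j |\<notin>| A. ?G j A)" if j: "j \<in> {1..n}" for j
  proof -
    let ?J = "N |-| {|j|}"
    have "j |\<in>| N" using j N by blast
    then have cJ: "fcard ?J = n - 1" using cN by (simp add: fcard_fminus_fsingleton)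
    \<comment> \<open>By \<open>card\<close>, the number of factors left over for the \<tau> is
      right exactly when \<open>A\<close> has \<open>k\<close> elements.\<close>
    have cA: "fcard T = fcard (?J |-| A) \<longleftrightarrow> fcard A = k" if "A |\<subseteq>| ?J" for A
      using fcard_mono[OF that] that card cJ by (auto simp: fcard_funion_fsubset)
    have G: "of_int (shuffle_sgn ?J {|j|}) * hmono A (of_int (shuffle_sgn A (?J |-| A)) * ?D (?J |-| A)) * ygen j ^ (CARD('p) ^ s) = ?G j A"
      if A: "A |\<subseteq>| ?J" for A
    proof -
      have sets: "?J |-| A = N |-| A |-| {|j|}" "A |\<union>| (N |-| A |-| {|j|}) = ?J"
          "(N |-| A |-| {|j|}) |\<union>| {|j|} = N |-| A"
        using A \<open>j |\<in>| N\<close> by blast+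
      \<comment> \<open>Both sides are the sign of joining \<open>A\<close>, the rest of its
        complement and \<open>j\<close>, associated in two ways.\<close>
      have sgn: "of_int (shuffle_sgn A (N |-| A |-| {|j|})) * of_int (shuffle_sgn ?J {|j|}) =
          (of_int (shuffle_sgn A (N |-| A)) * of_int (shuffle_sgn (N |-| A |-| {|j|}) {|j|}) :: 'p mod_ring ypoly)"
        using shuffle_sgn_assoc[of A "N |-| A |-| {|j|}" "{|j|}"] unfolding sets
        by (simp only: of_int_mult[symmetric])
      have "of_int (shuffle_sgn ?J {|j|}) * (of_int (shuffle_sgn A (N |-| A |-| {|j|})) * z) * ?y j =
          of_int (shuffle_sgn A (N |-| A)) * (of_int (shuffle_sgn (N |-| A |-| {|j|}) {|j|}) * ?y j * z)" for z
        using arg_cong[OF sgn, of "\<lambda>c. c * (?y j * z)"] by (simp only: mult_ac)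
      then show ?thesis
        by (simp only: sets of_int_mult_hmono hmono_mult_hpoly ygen_def flip: hpoly_power)
    qed
    have "of_int (shuffle_sgn ?J {|j|}) * tcoef (oprod lam_x ?J * lam_y j) (T, xi_exp s) =
        (\<Sum>A | A |\<subseteq>| ?J. if fcard T = fcard (?J |-| A) then ?G j A else 0)"
      unfolding mult_y tcoef_oprod_lam_x sum_distrib_left sum_distrib_right
    proof (intro sum.cong refl)
      fix A assume "A \<in> {A. A |\<subseteq>| ?J}"
      then have "A |\<subseteq>| ?J" by simp
      from G[OF this] show "of_int (shuffle_sgn ?J {|j|}) *
          ((if (0 :: nat \<Rightarrow>\<^sub>0 nat) = 0 \<and> fcard T = fcard (?J |-| A)
            then hmono A (of_int (shuffle_sgn A (?J |-| A)) * ?D (?J |-| A)) else 0) * ygen j ^ (CARD('p) ^ s)) =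
          (if fcard T = fcard (?J |-| A) then ?G j A else 0)"
        by (cases "fcard T = fcard (?J |-| A)")
          (simp_all only: simp_thms if_True if_False mult_zero_left mult_zero_right mult.assoc)
    qed
    also have "\<dots> = (\<Sum>A | A |\<subseteq>| ?J \<and> fcard A = k. ?G j A)"
      using cA fin[of ?J "\<lambda>_. True"] by (intro sum.mono_neutral_cong_right) auto
    also have "{A. A |\<subseteq>| ?J \<and> fcard A = k} = {A. A \<in> {A. A |\<subseteq>| N \<and> fcard A = k} \<and> j |\<notin>| A}"
      by blast
    finally show ?thesis .
  qed
  have "tcoef (lam u) (T, xi_exp s) = (\<Sum>j\<in>{1..n}. \<Sum>A | A \<in> {A. A |\<subseteq>| N \<and> fcard A = k} \<and> j |\<notin>| A. ?G j A)"
    unfolding lam by (intro sum.cong refl term_eq)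
  also have "\<dots> = (\<Sum>A\<in>{A. A |\<subseteq>| N \<and> fcard A = k}. \<Sum>j | j \<in> {1..n} \<and> j |\<notin>| A. ?G j A)"
    using fin by (intro sum.swap_restrict) auto
  also have "\<dots> = mui_bracket n k (flist T @ [s])"
    unfolding mui_bracket_eq[OF N]
  proof (intro sum.cong refl)
    fix A assume "A \<in> {A. A |\<subseteq>| N \<and> fcard A = k}"
    then have A: "A |\<subseteq>| N" "fcard A = k" by auto
    then have "fcard (N |-| A) = Suc (length (flist T))"
      using card cN by (simp add: fcard_funion_fsubset)
    moreover have "{j. j \<in> {1..n} \<and> j |\<notin>| A} = fset (N |-| A)"
      unfolding N[symmetric] by auto
    ultimately show "(\<Sum>j | j \<in> {1..n} \<and> j |\<notin>| A. ?G j A) =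
        hmono A (of_int (shuffle_sgn A (N |-| A)) * ydet (flist (N |-| A)) (flist T @ [s]))"
      by (simp only: ydet_expand_column_fset sum_distrib_left hmono_sum)
  qed
  finally show "tcoef (lam u) (T, xi_exp s) = mui_bracket n k (flist T @ [s])" .
qed

section \<open>The operations on the Mui invariants\<close>

lemma ecoef_mui_bracket_eq_0:
  assumes "fcard I \<noteq> k"
  shows "ecoef (mui_bracket n k a) I = 0"
proof -
  have N: "fset (fset_of_list [1..<n + 1]) = {1..n}" by (auto simp: fset_of_list.rep_eq)
  show ?thesis
    unfolding mui_bracket_eq[OF N] ecoef_sum using assms by (intro sum.neutral) auto
qed

text \<open>When all terms have the same exterior degree, the sign in the definition of
  \<open>St\<close> is common to them and factors out. Brackets qualify by
  \<open>ecoef_mui_bracket_eq_0\<close>.\<close>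

lemma St_eq_tcoef:
  assumes "\<And>I. ecoef u I \<noteq> 0 \<Longrightarrow> fcard I = d"
  shows "St S R u = minus_one_powi (int (length S) * (int d - int (length S))) *
    tcoef (lam u) (fset_of_list S, Poly_Mapping.nth R)"
proof -
  have "lam u = (\<Sum>I | ecoef u I \<noteq> 0. lam (hmono I (ecoef u I)))"
    unfolding lam_hmono by (simp add: lam_def)
  then show ?thesis
    unfolding St_def using assms by (simp add: sum_distrib_left)
qed

text \<open>List position \<open>i\<close> carries the exponent of \<xi>_(i+1), so
  \<open>Delta n r\<close> encodes \<xi>_r; for \<open>r = 0\<close> both sides are the zero
  exponent.\<close>

lemma nth_Delta:
  assumes "r \<le> n"
  shows "Poly_Mapping.nth (Delta n r) = xi_exp r"
  using assms by (intro poly_mapping_eqI)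
    (auto simp: xi_exp_def Delta_def nth_default_def lookup_single when_def simp del: upt_Suc)

text \<open>An exponent determines a list only up to trailing zeros; the prescribed length removes
  this ambiguity and bounds \<open>r\<close>.\<close>

lemma nth_eq_xi_exp:
  assumes "length R = n" "Poly_Mapping.nth R = xi_exp r"
  shows "r \<le> n" and "R = Delta n r"
proof -
  have lookup: "nth_default 0 R i = (if r = Suc i then 1 else 0)" for i
    using arg_cong[OF assms(2), of "\<lambda>m. Poly_Mapping.lookup m i"]
    by (auto simp: xi_exp_def lookup_single when_def)
  show "r \<le> n"
  proof (rule ccontr)
    assume "\<not> r \<le> n"
    then obtain i where "r = Suc i" "n \<le> i" by (metis Suc_le_D not_less_eq_eq)
    then show False using lookup[of i] assms(1) by (simp add: nth_default_def)
  qed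
  show "R = Delta n r"
  proof (rule nth_equalityI)
    show "length R = length (Delta n r)" using assms(1) by (simp add: Delta_def)
    fix i assume i: "i < length R"
    then show "R ! i = Delta n r ! i"
      using lookup[of i] assms(1) by (auto simp: nth_default_def Delta_def simp del: upt_Suc)
  qed
qed

section \<open>Sign exponents and column operations on brackets\<close>

lemma minus_one_powi_mult: "minus_one_powi a * (minus_one_powi b * x) = minus_one_powi (a + b) * (x :: 'r::ring_1)"
  by (auto simp: minus_one_powi_def)

lemma minus_one_powi_cong: "even (a - b) \<Longrightarrow> minus_one_powi a = minus_one_powi b"
  by (auto simp: minus_one_powi_def)

lemma minus_one_powi_int: "minus_one_powi (int m) = (-1) ^ m"
  by (simp add: minus_one_powi_def)

text \<open>Only the determinants depend on the columns, so a relation with one scalar for all row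
  lists passes to the brackets.\<close>

lemma mui_bracket_cong:
  assumes "\<And>J. set J \<subseteq> {1..n} \<Longrightarrow> length J = n - k \<Longrightarrow> ydet J a = (of_int c * ydet J b :: 'p::prime_card mod_ring ypoly)"
  shows "mui_bracket n k a = (of_int c * mui_bracket n k b :: 'p mod_ring coh)"
proof -
  have "ydet (sorted_list_of_set ({1..n} - I)) a =
      (of_int c * ydet (sorted_list_of_set ({1..n} - I)) b :: 'p mod_ring ypoly)"
    if "I \<in> {I. I \<subseteq> {1..n} \<and> card I = k}" for I
    using that finite_subset[of I "{1..n}"] by (intro assms) (auto simp: card_Diff_subset)
  then show ?thesis
    unfolding mui_bracket_def sum_distrib_left
    by (intro sum.cong refl) (simp add: hpoly_mult of_int_shift flip: of_int_coh)
qed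

lemma mui_bracket_move_column:
  assumes "k + length xs + length ys + 1 = n"
  shows "mui_bracket n k ((xs @ ys) @ [e]) =
    ((-1) ^ length ys * mui_bracket n k (xs @ e # ys) :: 'p::prime_card mod_ring coh)"
  using mui_bracket_cong[of n k "(xs @ ys) @ [e]" "(-1) ^ length ys" "xs @ e # ys", where 'p = 'p]
    ydet_move_column[where xs = xs and ys = ys and e = e and 'p = 'p] assms
  by simp

lemma mui_bracket_repeated_column:
  assumes "k + length a = n" "\<not> distinct a"
  shows "mui_bracket n k a = 0"
proof -
  have "mui_bracket n k a = of_int 0 * mui_bracket n k a"
    using assms by (intro mui_bracket_cong) (simp add: ydet_repeated_column)
  then show ?thesis by simp
qed

text \<open>The coefficients of the column relation are the same for every \<open>I\<close>, so the
  Dickson invariants can be taken out of the sum over \<open>I\<close>.\<close>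

lemma mui_bracket_last_column_dickson:
  assumes "k + length xs + 1 = n"
  shows "(mui_bracket n k (xs @ [n]) :: 'p::prime_card mod_ring coh) =
    (\<Sum>r<n. (-1) ^ (n - 1 - r) * (mui_bracket n k (xs @ [r]) * hpoly (dickson_Q n r)))"
proof -
  let ?J = "\<lambda>I. sorted_list_of_set ({1..n} - I)"
  have J: "ydet (?J I) (xs @ [n]) = (\<Sum>r<n. of_int ((-1) ^ (n - 1 - r)) * (ydet (?J I) (xs @ [r]) * (dickson_Q n r :: 'p mod_ring ypoly)))"
    if "I \<subseteq> {1..n}" "card I = k" for I
  proof -
    have "length (?J I) = Suc (length xs)"
      using that finite_subset[of I "{1..n}"] assms by (simp add: card_Diff_subset)
    then have "ydet (?J I) (xs @ [n]) =
        (\<Sum>r<n. (-1) ^ (n - 1 - r) * dickson_Q n r * (ydet (?J I) (xs @ [r]) :: 'p mod_ring ypoly))"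
      by (rule ydet_last_column_dickson) auto
    then show ?thesis by (simp add: mult_ac)
  qed
  have "(mui_bracket n k (xs @ [n]) :: 'p mod_ring coh) = (\<Sum>I | I \<subseteq> {1..n} \<and> card I = k. \<Sum>r<n.
      of_int ((-1) ^ (n - 1 - r)) * (of_int (sign (shuffle_perm n I)) *
        prod_list (map xgen (sorted_list_of_set I)) * hpoly (ydet (?J I) (xs @ [r])) * hpoly (dickson_Q n r)))"
    unfolding mui_bracket_def
  proof (intro sum.cong refl)
    fix I assume "I \<in> {I. I \<subseteq> {1..n} \<and> card I = k}"
    then have "I \<subseteq> {1..n}" "card I = k" by auto
    note J = J[OF this]
    let ?z = "of_int (sign (shuffle_perm n I)) * prod_list (map xgen (sorted_list_of_set I)) :: 'p mod_ring coh"
    show "?z * hpoly (ydet (?J I) (xs @ [n])) = (\<Sum>r<n. of_int ((-1) ^ (n - 1 - r)) *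
        (?z * hpoly (ydet (?J I) (xs @ [r])) * hpoly (dickson_Q n r)))"
      unfolding J hpoly_sum hpoly_mult of_int_coh[symmetric] sum_distrib_left
      by (intro sum.cong refl trans[OF of_int_shift]) (simp only: mult.assoc)
  qed
  also have "\<dots> = (\<Sum>r<n. of_int ((-1) ^ (n - 1 - r)) * (mui_bracket n k (xs @ [r]) * hpoly (dickson_Q n r)))"
    unfolding mui_bracket_def sum_distrib_left sum_distrib_right by (rule sum.swap)
  finally show ?thesis by simp
qed

text \<open>Restoring the increasing order moves \<open>s ! t\<close> past the larger elements of
  \<open>S'\<close>. Of the \<open>s ! t\<close> numbers below it, \<open>t\<close> lie in
  \<open>s\<close>, so \<open>s ! t - t\<close> elements of \<open>S'\<close> are smaller; the
  remaining ones give the sign.\<close>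

lemma mui_bracket_sort_column:
  fixes S :: "nat list"
  assumes S: "sorted_wrt (<) S" "set S \<subseteq> {1..<n}" and t: "t \<le> length S"
  defines "s \<equiv> 0 # S" and "S' \<equiv> sorted_list_of_set ({1..<n} - set S)"
  assumes n: "1 \<le> n"
  shows "(mui_bracket n (length S) (S' @ [s ! t]) :: 'p::prime_card mod_ring coh) =
    minus_one_powi (int n - 1 - int (length S) - int (s ! t) + int t) * mui n (omit_nth t s)"
proof -
  let ?k = "length S"
  define a where "a = s ! t"
  define P where "P i \<longleftrightarrow> i \<notin> set s" for i
  define xs ys where "xs = filter P [0..<a]" and "ys = filter P [a + 1..<n]"
  have s: "sorted_wrt (<) s" using S by (auto simp: s_def)
  then have dist: "distinct s" by (simp add: strict_sorted_iff)
  have len: "length s = Suc ?k" by (simp add: s_def)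
  have set_s: "set s \<subseteq> {0..<n}" using S(2) n by (auto simp: s_def)
  have "a \<in> set s" unfolding a_def using t len by (intro nth_mem) simp
  then have a: "a < n" "\<not> P a" using set_s by (auto simp: P_def)
  have a_notin: "filter (\<lambda>i. P i \<or> i = a) zs = filter P zs" if "a \<notin> set zs" for zs
    using that by (intro filter_cong) auto
  have sortd: "sorted_wrt (<) (filter Q [0..<n])" for Q by (intro sorted_wrt_filter) simp
  \<comment> \<open>Since 0 belongs to \<open>s\<close>, the complement of \<open>S\<close> in
    \<open>{1..<n}\<close> is that of \<open>s\<close> in \<open>{0..<n}\<close>.\<close>
  have S': "S' = xs @ ys"
  proof -
    have "S' = filter P [0..<n]"
      unfolding S'_def using sortd by (intro strict_sorted_equal) (auto simp: P_def s_def)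
    also have "\<dots> = xs @ ys" using a by (simp add: upt_split_at[OF a(1)] xs_def ys_def)
    finally show ?thesis .
  qed
  have "set (omit_nth t s) = set s - {a}"
  proof -
    have "sorted_list_of_set (set s - {a}) = omit_nth t s"
      unfolding a_def using s t len by (intro sorted_list_of_set_Diff_nth(1)) auto
    then show ?thesis by (metis finite_Diff finite_set set_sorted_list_of_set)
  qed
  then have "filter (\<lambda>i. i \<notin> set (omit_nth t s)) [0..<n] = filter (\<lambda>i. P i \<or> i = a) [0..<n]"
    by (intro filter_cong) (auto simp: P_def)
  also have "\<dots> = xs @ a # ys"
    using a_notin[of "[0..<a]"] a_notin[of "[a + 1..<n]"] by (simp add: upt_split_at[OF a(1)] xs_def ys_def)
  finally have mui: "mui n (omit_nth t s) = (mui_bracket n ?k (xs @ a # ys) :: 'p mod_ring coh)"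
    using t len by (simp add: mui_def)
  have "length S' = n - 1 - ?k" "?k \<le> n - 1"
    using S(2) card_mono[OF _ S(2)] \<open>sorted_wrt (<) S\<close>
    by (auto simp: S'_def card_Diff_subset distinct_card strict_sorted_iff)
  then have lens: "length xs + length ys + ?k + 1 = n" using n by (simp add: S')
  have "length xs + t = a"
  proof -
    have card_t: "card {x \<in> set s. x < a} = t"
      unfolding a_def using s t len by (intro sorted_list_of_set_Diff_nth(2)) auto
    have "{x \<in> set s. x < a} \<subseteq> {0..<a}" by auto
    from card_mono[OF finite_atLeastLessThan this] have "t \<le> a" by (simp add: card_t)
    have "set xs = {0..<a} - {x \<in> set s. x < a}" by (auto simp: xs_def P_def)
    moreover have "distinct xs" by (simp add: xs_def)
    ultimately have "length xs = card ({0..<a} - {x \<in> set s. x < a})" by (metis distinct_card)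
    also have "\<dots> = a - t" using card_t by (simp add: card_Diff_subset subset_iff)
    finally show ?thesis using \<open>t \<le> a\<close> by simp
  qed
  then have "minus_one_powi (int n - 1 - int ?k - int a + int t) = ((-1) ^ length ys :: 'p mod_ring coh)"
    unfolding minus_one_powi_int[symmetric] using lens by (intro minus_one_powi_cong) auto
  then show ?thesis
    using mui_bracket_move_column[of ?k xs ys n a, where 'p = 'p] lens
    by (simp add: S' mui flip: a_def)
qed

theorem proposition4p3:
  fixes n k :: nat and S R :: "nat list"
  assumes "odd CARD('p::prime_card)"
    and "1 \<le> n"
    and "length S = k"
    and "sorted_wrt (<) S"
    and "set S \<subseteq> {1..<n}"
    and "length R = n"
  defines "s \<equiv> 0 # S"
    and "S' \<equiv> sorted_list_of_set ({1..<n} - set S)"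
    and "M \<equiv> (mui n :: nat list \<Rightarrow> 'p mod_ring coh)"
  shows "(\<forall>t\<le>k. R = Delta n (s ! t) \<longrightarrow>
            St S' R (M [1..<n]) =
              minus_one_powi ((int k - 1) * (int n - 1 - int k) + int (s ! t) - int t) *
              M (omit_nth t s))
       \<and> (R = Delta n n \<longrightarrow>
            St S' R (M [1..<n]) =
              (\<Sum>t\<le>k. minus_one_powi (int k * (int n - int k) - int t) *
                 (M (omit_nth t s) * hpoly (dickson_Q n (s ! t)))))
       \<and> ((\<forall>t\<le>k. R \<noteq> Delta n (s ! t)) \<and> R \<noteq> Delta n n \<longrightarrow>
            St S' R (M [1..<n]) = 0)"
proof -
  define T where "T = fset_of_list S'"
  define u where "u = (mui_bracket n (n - 1) [0] :: 'p mod_ring coh)"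
  define m where "m = n - 1 - k"
  have S'_set: "set S' = {1..<n} - set S" by (simp add: S'_def)
  have flist: "flist T = S'" by (simp add: T_def fset_of_list.rep_eq S'_def)
  have lenS': "length S' = m" and kn: "k \<le> n - 1"
    using assms(3-5) card_mono[OF _ assms(5)]
    by (auto simp: S'_def m_def card_Diff_subset distinct_card strict_sorted_iff)
  then have cT: "k + fcard T + 1 = n"
    using assms(2) by (simp add: m_def flip: flist)
  have m: "int m = int n - 1 - int k" using kn assms(2) by (simp add: m_def)
  \<comment> \<open>Only the exponent 0 is left, so the class is the bracket [n - 1; 0].\<close>
  have "filter (\<lambda>a. a \<notin> {1..<n}) [0..<n] = [0]"
    using assms(2) by (simp add: upt_conv_Cons)
  then have Mu: "M [1..<n] = u" by (simp add: M_def mui_def u_def)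
  \<comment> \<open>There are \<open>m\<close> indices in \<open>S'\<close> and the class has
    exterior degree \<open>n - 1\<close>, which is \<open>m + k\<close>, so the sign exponent t(dim
    u - t) has the parity of \<open>m * k\<close>.\<close>
  have St: "St S' R u = minus_one_powi (int m * int k) * tcoef (lam u) (T, Poly_Mapping.nth R)"
  proof -
    have "St S' R u = minus_one_powi (int (length S') * (int (n - 1) - int (length S'))) *
        tcoef (lam u) (fset_of_list S', Poly_Mapping.nth R)"
      unfolding u_def by (rule St_eq_tcoef) (metis ecoef_mui_bracket_eq_0)
    moreover have "int (n - 1) - int (length S') = int k" using kn by (simp add: lenS' m_def)
    ultimately show ?thesis by (simp only: lenS' T_def)
  qed
  have St_Delta: "St S' R u = minus_one_powi (int m * int k) * mui_bracket n k (S' @ [r])"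
    if "R = Delta n r" "r \<le> n" for r
    using St tcoef_lam_mui_bracket(1)[OF assms(1) cT, of r] that
    by (simp add: nth_Delta flist u_def)
  have sort: "mui_bracket n k (S' @ [s ! t]) = minus_one_powi (int m - int (s ! t) + int t) * M (omit_nth t s)"
    if "t \<le> k" for t
    using mui_bracket_sort_column[OF assms(4,5), of t, where 'p = 'p] that assms(2,3)
    by (simp add: s_def S'_def M_def m)
  have s_less: "s ! t < n" if "t \<le> k" for t
    using that assms(2,3,5) nth_mem[of t s] by (auto simp: s_def)
  \<comment> \<open>Such an \<open>r\<close> is already one of the columns in
    \<open>S'\<close>.\<close>
  have rep: "mui_bracket n k (S' @ [r]) = (0 :: 'p mod_ring coh)" if "r < n" "r \<notin> set s" for r
    using that cT lenS' flist S'_set by (intro mui_bracket_repeated_column) (auto simp: s_def)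
  have 1: "St S' R u = minus_one_powi ((int k - 1) * (int n - 1 - int k) + int (s ! t) - int t) * M (omit_nth t s)"
    if "t \<le> k" "R = Delta n (s ! t)" for t
  proof -
    have "St S' R u = minus_one_powi (int m * int k + (int m - int (s ! t) + int t)) * M (omit_nth t s)"
      using St_Delta[OF that(2)] s_less[OF that(1)] sort[OF that(1)] by (simp add: minus_one_powi_mult)
    \<comment> \<open>The two exponents differ by twice \<open>m - s ! t + t\<close>.\<close>
    also have "minus_one_powi (int m * int k + (int m - int (s ! t) + int t)) =
        (minus_one_powi ((int k - 1) * (int n - 1 - int k) + int (s ! t) - int t) :: 'p mod_ring coh)"
      unfolding m[symmetric] by (rule minus_one_powi_cong) (simp add: algebra_simps)
    finally show ?thesis .
  qed
  have 2: "St S' R u = (\<Sum>t\<le>k. minus_one_powi (int k * (int n - int k) - int t) *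
      (M (omit_nth t s) * hpoly (dickson_Q n (s ! t))))" if "R = Delta n n"
  proof -
    let ?f = "\<lambda>r. (-1) ^ (n - 1 - r) * (mui_bracket n k (S' @ [r]) * hpoly (dickson_Q n r)) :: 'p mod_ring coh"
    have "mui_bracket n k (S' @ [n]) = (\<Sum>r<n. ?f r)"
      using cT flist lenS' by (intro mui_bracket_last_column_dickson) (metis length_sorted_list_of_set card_fset)
    also have "\<dots> = (\<Sum>r\<in>set s. ?f r)"
      using assms(2,5) rep by (intro sum.mono_neutral_right) (auto simp: s_def)
    \<comment> \<open>Only exponents outside \<open>S'\<close> contribute, and below
      \<open>n\<close> these are the entries of \<open>s\<close>.\<close>
    also have "\<dots> = (\<Sum>t<length s. ?f (s ! t))"
    proof (rule sum.reindex_bij_betw[symmetric], rule bij_betw_nth)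
      show "distinct s" using assms(4,5) by (auto simp: s_def strict_sorted_iff)
    qed auto
    also have "{..<length s} = {..k}" using assms(3) by (auto simp: s_def)
    finally have "St S' R u = (\<Sum>t\<le>k. minus_one_powi (int m * int k) * ?f (s ! t))"
      using St_Delta[OF that] by (simp add: sum_distrib_left)
    also have "\<dots> = (\<Sum>t\<le>k. minus_one_powi (int k * (int n - int k) - int t) *
        (M (omit_nth t s) * hpoly (dickson_Q n (s ! t))))"
    proof (intro sum.cong refl)
      fix t assume "t \<in> {..k}"
      then have t: "t \<le> k" by simp
      have "?f (s ! t) = minus_one_powi (int (n - 1 - s ! t)) *
          (minus_one_powi (int m - int (s ! t) + int t) * (M (omit_nth t s) * hpoly (dickson_Q n (s ! t))))"
        by (simp only: minus_one_powi_int sort[OF t] mult.assoc)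
      then have "minus_one_powi (int m * int k) * ?f (s ! t) =
          minus_one_powi (int m * int k + (int (n - 1 - s ! t) + (int m - int (s ! t) + int t))) *
          (M (omit_nth t s) * hpoly (dickson_Q n (s ! t)))"
        by (simp only: minus_one_powi_mult)
      moreover have "int (n - 1 - s ! t) = int n - 1 - int (s ! t)" using s_less[OF t] by simp
      \<comment> \<open>\<open>s ! t\<close> enters once from the Dickson relation and once from
        sorting the columns, so it drops out modulo 2.\<close>
      moreover have "minus_one_powi (int m * int k + (int n - 1 - int (s ! t) + (int m - int (s ! t) + int t))) =
          (minus_one_powi (int k * (int n - int k) - int t) :: 'p mod_ring coh)"
        unfolding m by (rule minus_one_powi_cong) (simp add: algebra_simps)
      ultimately show "minus_one_powi (int m * int k) * ?f (s ! t) =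
          minus_one_powi (int k * (int n - int k) - int t) * (M (omit_nth t s) * hpoly (dickson_Q n (s ! t)))"
        by simp
    qed
    finally show ?thesis .
  qed
  \<comment> \<open>If \<open>R\<close> encodes some \<xi>_r, then \<open>r < n\<close> lies outside
    \<open>s\<close> and a column is repeated; otherwise the corresponding coefficient of the
    coaction is zero.\<close>
  have 3: "St S' R u = 0" if "\<And>t. t \<le> k \<Longrightarrow> R \<noteq> Delta n (s ! t)" "R \<noteq> Delta n n"
  proof (cases "\<exists>r. Poly_Mapping.nth R = xi_exp r")
    case True
    then obtain r where r: "r \<le> n" "R = Delta n r" using nth_eq_xi_exp[OF assms(6)] by blast
    then have "r < n" using that(2) by (cases "r = n") auto
    moreover have "r \<notin> set s"
    proof
      assume "r \<in> set s"
      then obtain t where "t < length s" "r = s ! t" by (metis in_set_conv_nth)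
      then show False using that(1)[of t] r assms(3) by (simp add: s_def)
    qed
    ultimately show ?thesis using St_Delta[OF r(2,1)] rep by simp
  next
    case False
    then have "tcoef (lam u) (T, Poly_Mapping.nth R) = 0"
      unfolding u_def by (intro tcoef_lam_mui_bracket(2)[OF assms(1) cT]) blast
    then show ?thesis by (simp add: St)
  qed
  show ?thesis unfolding Mu using 1 2 3 by blast
qed

end
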